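(* Let $(W,d_W)$ be a compact metric space, let $\varphi\colon\mathbb{R}_+\times W\to W$, $(t,w)\mapsto t\cdot w$, be a continuous semiflow having the closing by periodic orbits property, and let $X\in \mathrm{C}(W,\mathbb{R}^{d\times d})$, $d\ge 1$. Then, driven by $\varphi$, $X$ is robustly periodically stable if and only if it is uniformly exponentially stable.
   Context: $\mathbb{R}_+=[0,\infty)$. $\|\cdot\|$ is the matrix norm on $\mathbb{R}^{d\times d}$ induced by a fixed vector norm on $\mathbb{R}^d$. $\mathrm{C}(W,\mathbb{R}^{d\times d})$ is the space of continuous maps $W\to\mathbb{R}^{d\times d}$ with the norm $\|X\|=\sup_{w\in W}\|X(w)\|$. Closing by periodic orbits property of $\varphi$: for every $\varepsilon>0$ there is $\delta>0$ such that if $w\in W$ satisfies $0<d_W(w,\tau\cdot w)<\delta$ for some $\tau\ge1$, then there is $\hat w\in W$ with $\hat w=\tau\cdot\hat w$ and $d_W(t\cdot w,t\cdot\hat w)<\varepsilon$ for all $0\le t\le\tau$. For $X\in\mathrm{C}(W,\mathbb{R}^{d\times d})$ and $w\in W$, $\mathscr{X}(t,w)$, $t\ge0$, denotes the fundamental matrix solution of the linear ODE $\dot x(t)=X(t\cdot w)x(t)$ with $\mathscr{X}(0,w)=I_d$; similarly $\mathscr{Y}(t,w)$ for $Y\in \mathrm{C}(W,\mathbb{R}^{d\times d})$. $X$ is uniformly exponentially stable driven by $\varphi$ if there are $C>0$ and $0<\gamma<1$ with $\|\mathscr{X}(t,w)\|\le C\gamma^t$ for all $t\ge0$ and $w\in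 W$. A point $p\in W$ is periodic if $p=\tau\cdot p$ for some $\tau>0$ (this includes fixed points). $X$ is robustly periodically stable driven by $\varphi$ if there is $\varepsilon>0$ such that for every $Y\in\mathrm{C}(W,\mathbb{R}^{d\times d})$ with $\|X-Y\|<\varepsilon$ and every periodic or fixed point $\tilde w$ of $\varphi$ there are constants $K_{Y,\tilde w}>0$ and $0<\gamma_{Y,\tilde w}<1$ with $\|\mathscr{Y}(t,\tilde w)\|\le K_{Y,\tilde w}\,\gamma_{Y,\tilde w}^{\,t}$ for all $t\ge0$. *)

theory Defs
  imports "HOL-Analysis.Analysis"
begin

definition vector_norm :: "(real ^ 'd \<Rightarrow> real) \<Rightarrow> bool" where
  "vector_norm N \<longleftrightarrow>
     (\<forall>x. 0 \<le> N x) \<and> (\<forall>x. N x = 0 \<longleftrightarrow> x = 0) \<and>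
     (\<forall>c x. N (c *\<^sub>R x) = \<bar>c\<bar> * N x) \<and>
     (\<forall>x y. N (x + y) \<le> N x + N y)"

text \<open>The operator norm with respect to an arbitrary vector norm \<open>N\<close>, in the style of
  \<^const>\<open>onorm\<close>; the vector \<open>x = 0\<close> contributes \<open>0 / 0 = 0\<close>. The library norm on
  matrices is the Frobenius norm, which for \<open>d \<ge> 2\<close> is not induced by a vector norm.\<close>

definition induced_norm :: "(real ^ 'd \<Rightarrow> real) \<Rightarrow> real ^ 'd ^ 'd \<Rightarrow> real" where
  "induced_norm N A = (SUP x. N (A *v x) / N x)"

definition sup_norm_on ::
    "(real ^ 'd \<Rightarrow> real) \<Rightarrow> 'w set \<Rightarrow> ('w \<Rightarrow> real ^ 'd ^ 'd) \<Rightarrow> real" where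
  "sup_norm_on N W X = (SUP w\<in>W. induced_norm N (X w))"

text \<open>Time is a real variable, but a semiflow is only constrained, and only used, at times
  \<open>t \<ge> 0\<close> and at points of \<open>W\<close>.\<close>

definition continuous_semiflow_on :: "'w::metric_space set \<Rightarrow> (real \<Rightarrow> 'w \<Rightarrow> 'w) \<Rightarrow> bool" where
  "continuous_semiflow_on W \<phi> \<longleftrightarrow>
     (\<forall>t\<ge>0. \<forall>w\<in>W. \<phi> t w \<in> W) \<and>
     (\<forall>w\<in>W. \<phi> 0 w = w) \<and>
     (\<forall>s\<ge>0. \<forall>t\<ge>0. \<forall>w\<in>W. \<phi> (s + t) w = \<phi> s (\<phi> t w)) \<and>
     continuous_on ({0..} \<times> W) (\<lambda>(t, w). \<phi> t w)"

definition closing_by_periodic_orbits ::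
    "'w::metric_space set \<Rightarrow> (real \<Rightarrow> 'w \<Rightarrow> 'w) \<Rightarrow> bool" where
  "closing_by_periodic_orbits W \<phi> \<longleftrightarrow>
     (\<forall>\<epsilon>>0. \<exists>\<delta>>0. \<forall>w\<in>W. \<forall>\<tau>\<ge>1.
        0 < dist w (\<phi> \<tau> w) \<and> dist w (\<phi> \<tau> w) < \<delta> \<longrightarrow>
        (\<exists>w'\<in>W. w' = \<phi> \<tau> w' \<and> (\<forall>t. 0 \<le> t \<and> t \<le> \<tau> \<longrightarrow> dist (\<phi> t w) (\<phi> t w') < \<epsilon>)))"

definition periodic_point :: "'w set \<Rightarrow> (real \<Rightarrow> 'w \<Rightarrow> 'w) \<Rightarrow> 'w \<Rightarrow> bool" where
  "periodic_point W \<phi> p \<longleftrightarrow> p \<in> W \<and> (\<exists>\<tau>>0. p = \<phi> \<tau> p)"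

definition fundamental_solution ::
    "(real \<Rightarrow> 'w \<Rightarrow> 'w) \<Rightarrow> ('w \<Rightarrow> real ^ 'd ^ 'd) \<Rightarrow> 'w \<Rightarrow> (real \<Rightarrow> real ^ 'd ^ 'd) \<Rightarrow> bool" where
  "fundamental_solution \<phi> X w M \<longleftrightarrow>
     M 0 = mat 1 \<and>
     (\<forall>t\<ge>0. (M has_vector_derivative (X (\<phi> t w) ** M t)) (at t within {0..}))"

text \<open>A fundamental solution, as a function on all of \<open>\<real>\<close>, is determined only on
  \<open>[0, \<infinity>)\<close>; hence the definite description ranges over its value at \<open>t\<close>, for \<open>t \<ge> 0\<close>.\<close>

definition fundamental_matrix ::
    "(real \<Rightarrow> 'w \<Rightarrow> 'w) \<Rightarrow> ('w \<Rightarrow> real ^ 'd ^ 'd) \<Rightarrow> real \<Rightarrow> 'w \<Rightarrow> real ^ 'd ^ 'd" where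
  "fundamental_matrix \<phi> X t w = (THE A. \<exists>M. fundamental_solution \<phi> X w M \<and> A = M t)"

definition uniformly_exponentially_stable ::
    "(real ^ 'd \<Rightarrow> real) \<Rightarrow> 'w set \<Rightarrow> (real \<Rightarrow> 'w \<Rightarrow> 'w) \<Rightarrow> ('w \<Rightarrow> real ^ 'd ^ 'd) \<Rightarrow> bool" where
  "uniformly_exponentially_stable N W \<phi> X \<longleftrightarrow>
     (\<exists>C \<gamma>. C > 0 \<and> 0 < \<gamma> \<and> \<gamma> < 1 \<and>
        (\<forall>t\<ge>0. \<forall>w\<in>W. induced_norm N (fundamental_matrix \<phi> X t w) \<le> C * \<gamma> powr t))"

definition robustly_periodically_stable ::
    "(real ^ 'd \<Rightarrow> real) \<Rightarrow> 'w::metric_space set \<Rightarrow> (real \<Rightarrow> 'w \<Rightarrow> 'w) \<Rightarrow>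
      ('w \<Rightarrow> real ^ 'd ^ 'd) \<Rightarrow> bool" where
  "robustly_periodically_stable N W \<phi> X \<longleftrightarrow>
     (\<exists>\<epsilon>>0. \<forall>Y. continuous_on W Y \<and> sup_norm_on N W (\<lambda>w. X w - Y w) < \<epsilon> \<longrightarrow>
        (\<forall>p. periodic_point W \<phi> p \<longrightarrow>
           (\<exists>K \<gamma>. K > 0 \<and> 0 < \<gamma> \<and> \<gamma> < 1 \<and>
              (\<forall>t\<ge>0. induced_norm N (fundamental_matrix \<phi> Y t p) \<le> K * \<gamma> powr t))))"

end

theory Submission
  imports Defs "HOL-Computational_Algebra.Fundamental_Theorem_Algebra"
begin

text \<open>
  If \<open>X\<close> is exponentially stable, a uniform contraction at some time \<open>T\<close> survives small perturbations.

  For the converse, let \<open>\<Psi>\<close> be the matrix of \<open>X\<close> over the minimal period \<open>\<tau>\<close> of a periodic point. By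
  robustness the powers of \<open>\<Psi>\<close>, and of its perturbations \<open>exp (\<kappa> \<tau>) (I + \<delta> E) \<Psi>\<close> with matrix units \<open>E\<close>, tend
  to zero, so their traces are bounded by the dimension. The difference of two such traces is \<open>\<delta> exp (\<kappa> \<tau>)\<close>
  times an entry of \<open>\<Psi>\<close>, so \<open>\<Psi>\<close> is of size \<open>exp (- \<kappa> \<tau>)\<close>, uniformly in the orbit, and the same holds for
  every coefficient matrix close to \<open>X\<close> along the orbit, in particular along a shadowing orbit segment.
  Periodic points of bounded period form a compact set, near which pointwise stability suffices. Together with
  the closing property, all orbit segments that nearly return to their initial point decay at a uniform rate.
  Finally, any orbit segment is made up of a bounded number of near returns and single time steps.
\<close>

subsection \<open>Matrix norms\<close>

text \<open>A spectral radius below 1 leaves the entries of a period matrix unbounded. Its trace,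
  however, is bounded by the dimension, and multiplying by a matrix unit before taking the trace
  reads off one entry; hence the perturbed traces.

  Perturbations are prescribed in time along an orbit but must come from functions on
  \<open>W\<close>, so the orbit may not meet itself early: the period has to be minimal. Fixed
  points have no minimal period, and for a short period the constant in front of the exponential,
  lost anew at every repetition, can outweigh the gain. For long periods half of the rate pays for
  it. This is why points of bounded period are treated separately.

  Shadowing leaves a coefficient error that does not shrink along the segment, so comparing the two
  solutions fails over long times. Instead the bound over one period is proved for every coefficient
  function within \<open>\<rho> / 4\<close> of \<open>X\<close> along the periodic orbit, and the
  shadowed segment itself supplies such functions. The tolerance \<rho> is spent as one quarter on
  this error, one quarter on the factor \<open>exp (\<kappa> * t)\<close> and one half on the matrix
  unit.\<close>

lemma norm_matrix_vector_mult_le: "norm ((A::real^'n^'m) *v x) \<le> norm A * norm x"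
proof -
  have "norm (A *v x) \<le> L2_set (\<lambda>i. norm (A $ i) * norm x) UNIV"
    unfolding norm_vec_def[of "A *v x"]
    by (rule L2_set_mono) (auto simp: matrix_vector_mul_component Cauchy_Schwarz_ineq2)
  also have "\<dots> = norm A * norm x"
    by (simp add: norm_vec_def[of A] L2_set_left_distrib)
  finally show ?thesis .
qed

lemma norm_transpose: "norm (transpose (A::real^'n^'m)) = norm A"
  unfolding norm_vec_def L2_set_def
  by (simp add: transpose_def sum_nonneg) (rule sum.swap)

lemma norm_matrix_mult_le: "norm ((A::real^'n^'m) ** (B::real^'k^'n)) \<le> norm A * norm B"
proof -
  have row: "(A ** B) $ i = transpose B *v (A $ i)" for i
    by (vector matrix_matrix_mult_def matrix_vector_mult_def transpose_def mult.commute)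
  have "norm ((A ** B) $ i) \<le> norm (A $ i) * norm B" for i
    using norm_matrix_vector_mult_le[of "transpose B" "A $ i"]
    unfolding row norm_transpose by (simp only: mult.commute)
  then have "norm (A ** B) \<le> L2_set (\<lambda>i. norm (A $ i) * norm B) UNIV"
    unfolding norm_vec_def[of "A ** B"] by (intro L2_set_mono) auto
  also have "\<dots> = norm A * norm B"
    by (simp add: norm_vec_def[of A] L2_set_left_distrib)
  finally show ?thesis .
qed

lemma norm_matrix_mult_mono:
  fixes A :: "real^'n^'m" and B :: "real^'k^'n"
  assumes "norm A \<le> a" "norm B \<le> b"
  shows "norm (A ** B) \<le> a * b"
proof -
  have "0 \<le> a" using assms(1) norm_ge_zero order_trans by blast
  then have "norm A * norm B \<le> a * b" using assms by (intro mult_mono) auto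
  then show ?thesis using norm_matrix_mult_le order_trans by blast
qed

lemma bounded_bilinear_matrix_mult:
  "bounded_bilinear ((**) :: real^'n^'m \<Rightarrow> real^'k^'n \<Rightarrow> real^'k^'m)"
proof
  show "(A + A') ** B = A ** B + A' ** B" for A A' :: "real^'n^'m" and B :: "real^'k^'n"
    by (vector matrix_matrix_mult_def sum.distrib algebra_simps)
  show "A ** (B + B') = A ** B + A ** B'" for A :: "real^'n^'m" and B B' :: "real^'k^'n"
    by (vector matrix_matrix_mult_def sum.distrib algebra_simps)
  show "(r *\<^sub>R A) ** B = r *\<^sub>R (A ** B)" for r and A :: "real^'n^'m" and B :: "real^'k^'n"
    by (vector matrix_matrix_mult_def sum_distrib_left mult.assoc)
  show "A ** (r *\<^sub>R B) = r *\<^sub>R (A ** B)" for r and A :: "real^'n^'m" and B :: "real^'k^'n"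
    by (vector matrix_matrix_mult_def sum_distrib_left mult.left_commute)
  show "\<exists>K. \<forall>(A::real^'n^'m) (B::real^'k^'n). norm (A ** B) \<le> norm A * norm B * K"
    by (rule exI[of _ 1]) (simp add: norm_matrix_mult_le)
qed

interpretation matrix_mult: bounded_bilinear "(**) :: real^'n^'m \<Rightarrow> real^'k^'n \<Rightarrow> real^'k^'m"
  by (rule bounded_bilinear_matrix_mult)

lemma norm_matrix_le_sum_entries: "norm (A::real^'n^'m) \<le> (\<Sum>i\<in>UNIV. \<Sum>j\<in>UNIV. \<bar>A $ i $ j\<bar>)"
proof -
  have "norm A \<le> (\<Sum>i\<in>UNIV. norm (A $ i))"
    by (simp add: norm_vec_def L2_set_le_sum)
  also have "\<dots> \<le> (\<Sum>i\<in>UNIV. \<Sum>j\<in>UNIV. \<bar>A $ i $ j\<bar>)"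
    by (intro sum_mono) (simp add: norm_le_l1_cart)
  finally show ?thesis .
qed

lemma abs_matrix_entry_le_norm: "\<bar>(A::real^'n^'m) $ i $ j\<bar> \<le> norm A"
  using component_le_norm_cart[of "A $ i" j] Finite_Cartesian_Product.norm_nth_le[of A i] by simp

lemma norm_mat_1_le: "norm (mat 1 :: real^'n^'n) \<le> CARD('n)"
proof -
  have "norm (mat 1 :: real^'n^'n) \<le> (\<Sum>i\<in>UNIV. \<Sum>j\<in>UNIV. \<bar>(mat 1 :: real^'n^'n) $ i $ j\<bar>)"
    by (rule norm_matrix_le_sum_entries)
  also have "\<dots> = (\<Sum>i\<in>(UNIV::'n set). \<Sum>j\<in>(UNIV::'n set). if i = j then 1 else 0)"
    by (intro sum.cong refl) (simp add: mat_def)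
  finally show ?thesis by simp
qed

subsection \<open>The trace of a matrix with vanishing powers\<close>

text \<open>The logarithmic derivative of p at 0 is minus the sum of the reciprocals of the roots,
  and each reciprocal has modulus at most 1. Splitting off one linear factor at a time avoids root
  multiplicities.\<close>

lemma norm_poly_pderiv_0_le:
  fixes p :: "complex poly"
  assumes "\<And>z. poly p z = 0 \<Longrightarrow> 1 \<le> norm z"
  shows "norm (poly (pderiv p) 0) \<le> degree p * norm (poly p 0)"
  using assms
proof (induction "degree p" arbitrary: p)
  case 0
  then obtain c where "p = [:c:]" by (metis degree_eq_zeroE)
  then show ?case by (simp add: pderiv_pCons)
next
  case (Suc n)
  then have "\<not> constant (poly p)" by (simp add: constant_degree)
  then obtain r where r: "poly p r = 0" using fundamental_theorem_of_algebra by blast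
  then obtain q where q: "p = [:-r, 1:] * q" by (auto simp: poly_eq_0_iff_dvd elim: dvdE)
  have "q \<noteq> 0" using Suc.hyps q by auto
  then have deg: "degree p = Suc (degree q)" by (simp add: q degree_mult_eq del: mult_pCons_left)
  have IH: "norm (poly (pderiv q) 0) \<le> degree q * norm (poly q 0)"
    using Suc.hyps deg Suc.prems by (intro Suc.hyps(1)) (auto simp: q)
  have r1: "1 \<le> norm r" using Suc.prems r by blast
  have "norm (poly (pderiv p) 0) = norm (poly q 0 - r * poly (pderiv q) 0)"
    by (simp add: q pderiv_mult pderiv_pCons del: mult_pCons_left)
  also have "\<dots> \<le> norm (poly q 0) + norm r * norm (poly (pderiv q) 0)"
    by (metis norm_mult norm_triangle_ineq4)
  also have "\<dots> \<le> norm r * norm (poly q 0) + norm r * (degree q * norm (poly q 0))"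
    using r1 mult_right_mono[OF r1, of "norm (poly q 0)"] by (intro add_mono mult_left_mono IH) auto
  also have "\<dots> = degree p * norm (poly p 0)"
    by (simp add: deg, simp add: q norm_mult algebra_simps)
  finally show ?case .
qed

text \<open>This is det (I - z B), the reversed characteristic polynomial. Its roots are the
  reciprocals of the nonzero eigenvalues, so eigenvalues in the closed unit disc become roots of
  modulus at least 1.\<close>

definition rev_char_poly :: "real^'n^'n \<Rightarrow> complex poly" where
  "rev_char_poly B = det (\<chi> i j. [:if i = j then 1 else 0, - of_real (B $ i $ j):])"

lemma rev_char_poly_alt:
  "rev_char_poly (B::real^'n^'n) = (\<Sum>p\<in>{p. p permutes UNIV}. of_int (sign p) *
     (\<Prod>i\<in>UNIV. [:if i = p i then 1 else 0, - of_real (B $ i $ p i):]))"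
  by (simp add: rev_char_poly_def det_def)

lemma poly_rev_char_poly:
  "poly (rev_char_poly B) z = det (\<chi> i j. (if i = j then 1 else 0) - z * of_real (B $ i $ j))"
  by (simp add: rev_char_poly_alt det_def poly_sum poly_prod)

lemma degree_rev_char_poly: "degree (rev_char_poly (B::real^'n^'n)) \<le> CARD('n)"
  unfolding rev_char_poly_alt
proof (intro degree_sum_le finite_permutations finite order_trans[OF degree_mult_le])
  fix p :: "'n \<Rightarrow> 'n"
  have "degree [:a, b::complex:] \<le> 1" for a b by simp
  then have "degree (\<Prod>i\<in>UNIV. [:if i = p i then 1 else 0, - complex_of_real (B $ i $ p i):])
      \<le> (\<Sum>i\<in>(UNIV::'n set). 1)"
    by (intro order_trans[OF degree_prod_sum_le] sum_mono finite) (simp only: o_def)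
  then show "degree (of_int (sign p) :: complex poly) +
      degree (\<Prod>i\<in>UNIV. [:if i = p i then 1 else 0, - complex_of_real (B $ i $ p i):]) \<le> CARD('n)"
    by simp
qed

lemma poly_rev_char_poly_0: "poly (rev_char_poly (B::real^'n^'n)) 0 = 1"
proof -
  have "(\<chi> i j. (if i = j then 1 else 0)) = (mat 1 :: complex^'n^'n)"
    by (simp add: mat_def)
  then show ?thesis by (simp add: poly_rev_char_poly)
qed

text \<open>In the Leibniz expansion at z = 0 a permutation other than the identity still has a
  vanishing off-diagonal factor after one factor has been differentiated.\<close>

lemma poly_pderiv_rev_char_poly_0:
  "poly (pderiv (rev_char_poly (B::real^'n^'n))) 0 = - of_real (trace B)"
proof -
  let ?f = "\<lambda>p i. \<Prod>j\<in>UNIV - {i}. (if j = p j then 1 else (0::complex))"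
  have sign: "pderiv (of_int n :: complex poly) = 0" for n
    by (simp add: of_int_poly pderiv_pCons)
  have "poly (pderiv (rev_char_poly B)) 0 = (\<Sum>p\<in>{p. p permutes UNIV}. of_int (sign p) *
     (\<Sum>i\<in>UNIV. ?f p i * (- of_real (B $ i $ p i))))"
    by (simp add: rev_char_poly_alt higher_pderiv_sum[of 1, simplified] pderiv_mult pderiv_prod
        pderiv_pCons poly_sum poly_prod sign mult.commute)
  also have "\<dots> = (\<Sum>p\<in>{id}. of_int (sign p) * (\<Sum>i\<in>UNIV. ?f p i * (- of_real (B $ i $ p i))))"
  proof (rule sum.mono_neutral_right)
    show "finite {p::'n\<Rightarrow>'n. p permutes UNIV}" by (simp add: finite_permutations)
    show "{id} \<subseteq> {p::'n\<Rightarrow>'n. p permutes UNIV}" by (simp add: permutes_id)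
    show "\<forall>p\<in>{p. p permutes UNIV} - {id}. of_int (sign p) *
        (\<Sum>i\<in>UNIV. ?f p i * (- of_real (B $ i $ p i))) = (0::complex)"
    proof
      fix p :: "'n \<Rightarrow> 'n" assume p: "p \<in> {p. p permutes UNIV} - {id}"
      have "?f p i = 0" for i
      proof -
        \<comment> \<open>A permutation cannot move exactly one point, so besides i it moves some
          other j.\<close>
        have "\<exists>j. j \<noteq> i \<and> p j \<noteq> j"
        proof (rule ccontr)
          assume "\<not> ?thesis"
          then have fix_pt: "p j = j" if "j \<noteq> i" for j using that by blast
          have "inj p" using p permutes_inj by blast
          then have "p i = i" using fix_pt by (metis injD)
          then have "p j = j" for j using fix_pt by (cases "j = i") auto
          then have "p = id" by (simp add: fun_eq_iff)
          then show False using p by simp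
        qed
        then obtain j where "j \<noteq> i" "p j \<noteq> j" by blast
        then show ?thesis by (intro prod_zero) (auto intro!: bexI[of _ j])
      qed
      then show "of_int (sign p) * (\<Sum>i\<in>UNIV. ?f p i * (- of_real (B $ i $ p i))) = (0::complex)"
        by (simp only: mult_zero_left mult_zero_right sum.neutral_const)
    qed
  qed
  also have "\<dots> = - of_real (trace B)"
    by (simp add: trace_def sum_negf)
  finally show ?thesis .
qed

text \<open>A root z gives a nonzero v with v = z B v, hence v = z^k B^k v for all k. If |z| < 1,
  the right-hand side tends to 0.\<close>

lemma rev_char_poly_root_norm_ge_1:
  fixes B :: "real^'n^'n"
  assumes lim: "(\<lambda>k. (((**) B) ^^ k) (mat 1)) \<longlonglongrightarrow> 0"
    and root: "poly (rev_char_poly B) z = 0"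
  shows "1 \<le> norm z"
proof (rule ccontr)
  assume z1: "\<not> 1 \<le> norm z"
  define D :: "complex^'n^'n" where "D = (\<chi> i j. (if i = j then 1 else 0) - z * of_real (B $ i $ j))"
  have "det D = 0"
    using root by (simp add: poly_rev_char_poly D_def)
  then have "\<not> (\<exists>D'. D' ** D = mat 1)"
    using invertible_det_nz[of D] invertible_left_inverse[of D] by simp
  then obtain v :: "complex^'n" where v: "v \<noteq> 0" and "D *v v = 0"
    unfolding matrix_left_invertible_ker by blast
  have vi: "v $ i = z * (\<Sum>j\<in>UNIV. of_real (B $ i $ j) * v $ j)" for i
  proof -
    have "0 = (D *v v) $ i" using \<open>D *v v = 0\<close> by simp
    also have "\<dots> = (\<Sum>j\<in>UNIV. (if i = j then v $ j else 0) - z * (of_real (B $ i $ j) * v $ j))"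
      unfolding D_def matrix_vector_mult_def by (auto intro!: sum.cong simp: left_diff_distrib)
    also have "\<dots> = v $ i - z * (\<Sum>j\<in>UNIV. of_real (B $ i $ j) * v $ j)"
      by (simp add: sum_subtractf sum_distrib_left)
    finally show ?thesis by simp
  qed
  define P where "P k = (((**) B) ^^ k) (mat 1)" for k
  have vk: "v $ i = z ^ k * (\<Sum>j\<in>UNIV. of_real (P k $ i $ j) * v $ j)" for k i
  proof (induction k arbitrary: i)
    case 0
    have "(\<Sum>j\<in>UNIV. of_real (P 0 $ i $ j) * v $ j) = (\<Sum>j\<in>UNIV. if i = j then v $ j else 0)"
      by (rule sum.cong) (auto simp: P_def mat_def)
    then show ?case by simp
  next
    case (Suc k)
    have "v $ i = z * (\<Sum>l\<in>UNIV. of_real (B $ i $ l) * v $ l)" by (rule vi)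
    also have "\<dots> = z * (\<Sum>l\<in>UNIV. of_real (B $ i $ l) *
        (z ^ k * (\<Sum>j\<in>UNIV. of_real (P k $ l $ j) * v $ j)))"
      using Suc.IH by (intro arg_cong[where f="(*) z"] sum.cong refl) metis
    also have "\<dots> = z ^ Suc k * (\<Sum>l\<in>UNIV. \<Sum>j\<in>UNIV. of_real (B $ i $ l) * of_real (P k $ l $ j) * v $ j)"
      by (simp add: sum_distrib_left algebra_simps)
    also have "\<dots> = z ^ Suc k * (\<Sum>j\<in>UNIV. of_real (P (Suc k) $ i $ j) * v $ j)"
      by (subst sum.swap) (simp add: P_def matrix_matrix_mult_def sum_distrib_right)
    finally show ?case .
  qed
  have "v $ i = 0" for i
  proof -
    have "(\<lambda>k. P k $ i $ j) \<longlonglongrightarrow> 0" for j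
      using tendsto_vec_nth[OF tendsto_vec_nth[OF lim, of i], of j] by (simp add: P_def)
    then have "(\<lambda>k. z ^ k * (\<Sum>j\<in>UNIV. of_real (P k $ i $ j) * v $ j)) \<longlonglongrightarrow> 0 * (\<Sum>j\<in>UNIV. of_real 0 * v $ j)"
      using z1 by (intro tendsto_intros LIMSEQ_power_zero) auto
    then have "(\<lambda>k. v $ i) \<longlonglongrightarrow> 0" using vk by simp
    then show ?thesis by (simp add: LIMSEQ_const_iff)
  qed
  with v show False by (simp add: vec_eq_iff)
qed

text \<open>The trace is a sum of eigenvalues of modulus at most 1. This is read off from the first
  two coefficients of \<open>rev_char_poly B\<close>.\<close>

lemma abs_trace_le_card:
  fixes B :: "real^'n^'n"
  assumes "(\<lambda>k. (((**) B) ^^ k) (mat 1)) \<longlonglongrightarrow> 0"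
  shows "\<bar>trace B\<bar> \<le> CARD('n)"
proof -
  have "norm (poly (pderiv (rev_char_poly B)) 0) \<le> degree (rev_char_poly B) * norm (poly (rev_char_poly B) 0)"
    using rev_char_poly_root_norm_ge_1[OF assms] by (intro norm_poly_pderiv_0_le)
  then show ?thesis
    using degree_rev_char_poly[of B] by (simp add: poly_pderiv_rev_char_poly_0 poly_rev_char_poly_0)
qed

subsection \<open>Linear matrix differential equations\<close>

text \<open>A Gronwall estimate for the squared norm. In the rate \<open>2 * c + 1\<close> the term
  \<open>2 * c\<close> comes from A, and the 1 from splitting the product of |Z| and |f| into
  squares.\<close>

lemma linear_ode_comparison:
  fixes A Z f :: "real \<Rightarrow> real^'n^'n"
  assumes "0 \<le> T"
    and deriv: "\<And>t. 0 \<le> t \<Longrightarrow> t \<le> T \<Longrightarrow>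
      (Z has_vector_derivative (A t ** Z t + f t)) (at t within {0..T})"
    and A: "\<And>t. 0 \<le> t \<Longrightarrow> t \<le> T \<Longrightarrow> norm (A t) \<le> c"
    and f: "\<And>t. 0 \<le> t \<Longrightarrow> t \<le> T \<Longrightarrow> norm (f t) \<le> e"
  shows "(norm (Z T))\<^sup>2 \<le> ((norm (Z 0))\<^sup>2 + e\<^sup>2 * T) * exp ((2 * c + 1) * T)"
proof -
  have c: "0 \<le> c" using A[of 0] \<open>0 \<le> T\<close> norm_ge_zero order_trans by blast
  define k where "k = 2 * c + 1"
  have k: "0 \<le> k" using c by (simp add: k_def)
  \<comment> \<open>The weight cancels the growth of the squared norm, and the linear term absorbs
    the forcing, so u does not increase.\<close>
  define u where "u t = (Z t \<bullet> Z t) * exp (- (k * t)) - e\<^sup>2 * t" for t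
  have contZ: "continuous_on {0..T} Z"
    using deriv by (intro continuous_on_vector_derivative) auto
  have "u T \<le> u 0"
  proof (rule DERIV_nonpos_imp_decreasing_open[OF \<open>0 \<le> T\<close>])
    show "continuous_on {0..T} u"
      unfolding u_def by (intro continuous_intros contZ)
    fix t assume t: "0 < t" "t < T"
    then have "(Z has_vector_derivative (A t ** Z t + f t)) (at t)"
      using deriv[of t] by (simp add: at_within_Icc_at)
    then have dZ: "(Z has_derivative (\<lambda>h. h *\<^sub>R (A t ** Z t + f t))) (at t)"
      by (simp add: has_vector_derivative_def)
    let ?d = "(2 * (Z t \<bullet> (A t ** Z t + f t)) - k * (Z t \<bullet> Z t)) * exp (- (k * t)) - e\<^sup>2"
    have "(u has_derivative (\<lambda>h. h * ?d)) (at t)"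
      unfolding u_def
      by (rule derivative_eq_intros dZ refl)+ (simp add: algebra_simps inner_commute)
    then have "(u has_real_derivative ?d) (at t)"
      by (rule has_derivative_imp_has_field_derivative) simp
    moreover have "?d \<le> 0"
    proof -
      have "Z t \<bullet> (A t ** Z t) \<le> norm (Z t) * (c * norm (Z t))"
        using A[of t] t by (intro order_trans[OF norm_cauchy_schwarz] mult_left_mono
            order_trans[OF norm_matrix_mult_le] mult_right_mono) auto
      moreover have "Z t \<bullet> f t \<le> norm (Z t) * e"
        using f[of t] t by (intro order_trans[OF norm_cauchy_schwarz] mult_left_mono) auto
      moreover have "2 * (norm (Z t) * e) \<le> (norm (Z t))\<^sup>2 + e\<^sup>2"
        using sum_squares_bound[of "norm (Z t)" e] by simp
      ultimately have "2 * (Z t \<bullet> (A t ** Z t + f t)) - k * (Z t \<bullet> Z t) \<le> e\<^sup>2"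
        by (simp add: k_def inner_add_right power2_norm_eq_inner[symmetric] power2_eq_square algebra_simps)
      then have "(2 * (Z t \<bullet> (A t ** Z t + f t)) - k * (Z t \<bullet> Z t)) * exp (- (k * t)) \<le> e\<^sup>2 * exp (- (k * t))"
        by (rule mult_right_mono) simp
      also have "\<dots> \<le> e\<^sup>2 * 1" using k t by (intro mult_left_mono) auto
      finally show ?thesis by simp
    qed
    ultimately show "\<exists>y. (u has_real_derivative y) (at t) \<and> y \<le> 0" by blast
  qed
  then have "(norm (Z T))\<^sup>2 * exp (- (k * T)) \<le> (norm (Z 0))\<^sup>2 + e\<^sup>2 * T"
    by (simp add: u_def power2_norm_eq_inner)
  then show ?thesis
    unfolding k_def[symmetric] by (simp add: exp_minus field_simps)
qed

lemma linear_ode_unique: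
  fixes A M M' :: "real \<Rightarrow> real^'n^'n"
  assumes "0 \<le> T"
    and M: "\<And>t. 0 \<le> t \<Longrightarrow> t \<le> T \<Longrightarrow> (M has_vector_derivative A t ** M t) (at t within {0..T})"
    and M': "\<And>t. 0 \<le> t \<Longrightarrow> t \<le> T \<Longrightarrow> (M' has_vector_derivative A t ** M' t) (at t within {0..T})"
    and A: "\<And>t. 0 \<le> t \<Longrightarrow> t \<le> T \<Longrightarrow> norm (A t) \<le> c"
    and "M 0 = M' 0"
  shows "M T = M' T"
proof -
  have "(norm (M T - M' T))\<^sup>2 \<le> ((norm (M 0 - M' 0))\<^sup>2 + 0\<^sup>2 * T) * exp ((2 * c + 1) * T)"
  proof (rule linear_ode_comparison[where A = A and f = "\<lambda>_. 0" and Z = "\<lambda>t. M t - M' t"])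
    show "((\<lambda>t. M t - M' t) has_vector_derivative A t ** (M t - M' t) + 0) (at t within {0..T})"
      if "0 \<le> t" "t \<le> T" for t
      using has_vector_derivative_diff[OF M[OF that] M'[OF that]]
      by (simp add: matrix_mult.diff_right)
  qed (use assms in auto)
  then show ?thesis using \<open>M 0 = M' 0\<close> by simp
qed

definition ode_growth :: "real \<Rightarrow> real \<Rightarrow> real" where
  "ode_growth c T = exp ((2 * c + 1) * T)"

lemma ode_growth_ge_1: "0 \<le> c \<Longrightarrow> 0 \<le> T \<Longrightarrow> 1 \<le> ode_growth c T"
  by (simp add: ode_growth_def)

lemma ode_growth_mono: "0 \<le> c \<Longrightarrow> 0 \<le> S \<Longrightarrow> S \<le> T \<Longrightarrow> ode_growth c S \<le> ode_growth c T"
  by (simp add: ode_growth_def mult_left_mono)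

lemma linear_ode_growth:
  fixes A M :: "real \<Rightarrow> real^'n^'n"
  assumes "0 \<le> T"
    and M: "\<And>t. 0 \<le> t \<Longrightarrow> t \<le> T \<Longrightarrow> (M has_vector_derivative A t ** M t) (at t within {0..T})"
    and A: "\<And>t. 0 \<le> t \<Longrightarrow> t \<le> T \<Longrightarrow> norm (A t) \<le> c"
  shows "norm (M T) \<le> norm (M 0) * ode_growth c T"
proof -
  have c: "0 \<le> c" using A[of 0] \<open>0 \<le> T\<close> norm_ge_zero order_trans by blast
  have "(norm (M T))\<^sup>2 \<le> ((norm (M 0))\<^sup>2 + 0\<^sup>2 * T) * exp ((2 * c + 1) * T)"
    using assms by (intro linear_ode_comparison[where A = A and f = "\<lambda>_. 0"]) auto
  also have "\<dots> = (norm (M 0))\<^sup>2 * ode_growth c T"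
    by (simp add: ode_growth_def)
  \<comment> \<open>The growth factor belongs to squared norms; being at least 1, it may be squared,
    which avoids a root.\<close>
  also have "\<dots> \<le> (norm (M 0))\<^sup>2 * (ode_growth c T)\<^sup>2"
    using ode_growth_ge_1[OF c \<open>0 \<le> T\<close>] by (intro mult_left_mono) (auto simp: power2_eq_square)
  finally have "(norm (M T))\<^sup>2 \<le> (norm (M 0) * ode_growth c T)\<^sup>2"
    by (simp add: power_mult_distrib)
  then show ?thesis
    by (rule power2_le_imp_le) (simp add: ode_growth_def)
qed

text \<open>M - P starts at 0 and solves the equation of M with forcing (A - B) P, so the bound is
  proportional to e.\<close>

lemma linear_ode_perturbation:
  fixes A B M P :: "real \<Rightarrow> real^'n^'n"
  assumes "0 \<le> T"
    and M: "\<And>t. 0 \<le> t \<Longrightarrow> t \<le> T \<Longrightarrow> (M has_vector_derivative A t ** M t) (at t within {0..T})"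
    and P: "\<And>t. 0 \<le> t \<Longrightarrow> t \<le> T \<Longrightarrow> (P has_vector_derivative B t ** P t) (at t within {0..T})"
    and A: "\<And>t. 0 \<le> t \<Longrightarrow> t \<le> T \<Longrightarrow> norm (A t) \<le> c"
    and Pm: "\<And>t. 0 \<le> t \<Longrightarrow> t \<le> T \<Longrightarrow> norm (P t) \<le> m"
    and AB: "\<And>t. 0 \<le> t \<Longrightarrow> t \<le> T \<Longrightarrow> norm (A t - B t) \<le> e"
    and "M 0 = P 0"
  shows "norm (M T - P T) \<le> e * (m * sqrt (T * ode_growth c T))"
proof -
  have e: "0 \<le> e" using AB[of 0] \<open>0 \<le> T\<close> norm_ge_zero order_trans by blast
  have m: "0 \<le> m" using Pm[of 0] \<open>0 \<le> T\<close> norm_ge_zero order_trans by blast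
  have "(norm (M T - P T))\<^sup>2 \<le> ((norm (M 0 - P 0))\<^sup>2 + (e * m)\<^sup>2 * T) * exp ((2 * c + 1) * T)"
  proof (rule linear_ode_comparison[where A = A and f = "\<lambda>t. (A t - B t) ** P t" and Z = "\<lambda>t. M t - P t"])
    fix t assume t: "0 \<le> t" "t \<le> T"
    show "((\<lambda>t. M t - P t) has_vector_derivative A t ** (M t - P t) + (A t - B t) ** P t) (at t within {0..T})"
      using has_vector_derivative_diff[OF M[OF t] P[OF t]]
      by (simp add: matrix_mult.diff_right matrix_mult.diff_left)
    show "norm ((A t - B t) ** P t) \<le> e * m"
      using AB[OF t] Pm[OF t] e by (intro order_trans[OF norm_matrix_mult_le] mult_mono) auto
  qed (use assms in auto)
  also have "\<dots> = (e * (m * sqrt (T * ode_growth c T)))\<^sup>2"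
    using \<open>0 \<le> T\<close> \<open>M 0 = P 0\<close> by (simp add: ode_growth_def power_mult_distrib)
  finally show ?thesis
    by (rule power2_le_imp_le) (use e m \<open>0 \<le> T\<close> in \<open>simp add: ode_growth_def\<close>)
qed

text \<open>Picard iteration in the exponentially weighted supremum norm, for which the integral
  operator is a contraction on the whole half line.\<close>
lemma linear_ode_exists:
  fixes A :: "real \<Rightarrow> real^'n^'n"
  assumes contA: "continuous_on {0..} A" and A: "\<And>t. 0 \<le> t \<Longrightarrow> norm (A t) \<le> c"
  shows "\<exists>M. M 0 = mat 1 \<and> (\<forall>t\<ge>0. (M has_vector_derivative A t ** M t) (at t within {0..}))"
proof -
  define k where "k = \<bar>c\<bar> + 1"
  have k: "0 < k" by (simp add: k_def)
  have Ak: "norm (A t) \<le> k" if "0 \<le> t" for t using A[OF that] by (simp add: k_def)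
  \<comment> \<open>Here g stands for the solution damped by \<open>exp (- (2 * k * t))\<close>; the
    weight in the integrand undoes the damping. As k bounds A, the rate 2k makes the contraction
    factor 1/2.\<close>
  define I where "I g t = integral {0..t} (\<lambda>s. exp (2 * k * s) *\<^sub>R (A s ** apply_bcontfun g s))" for g :: "real \<Rightarrow>\<^sub>C (real^'n^'n)" and t
  have contg: "continuous_on S (apply_bcontfun g)" for S and g :: "real \<Rightarrow>\<^sub>C (real^'n^'n)"
    by simp
  have contI0: "continuous_on {0..t} (\<lambda>s. exp (2 * k * s) *\<^sub>R (A s ** apply_bcontfun g s))" for g t
    using contA by (intro continuous_intros matrix_mult.continuous_on contg)
      (auto elim: continuous_on_subset)
  have derivI: "(I g has_vector_derivative exp (2 * k * t) *\<^sub>R (A t ** g t)) (at t within {0..})"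
    if t: "0 \<le> t" for g t
  proof -
    have "(I g has_vector_derivative exp (2 * k * t) *\<^sub>R (A t ** g t)) (at t within {0..t + 1})"
      unfolding I_def using t by (intro integral_has_vector_derivative contI0) auto
    moreover have "at t within {0..t + 1} = at t within {0..}"
      using t by (intro at_within_nhd[of _ "{t - 1<..<t + 1}"]) auto
    ultimately show ?thesis by simp
  qed
  have normI: "norm (I g t - I h t) \<le> dist g h * (exp (2 * k * t) - 1) / 2" if t: "0 \<le> t" for g h t
  proof -
    have int: "((\<lambda>s. k * dist g h * exp (2 * k * s)) has_integral
        (dist g h * exp (2 * k * t) / 2 - dist g h * exp (2 * k * 0) / 2)) {0..t}"
      using k t
      by (intro fundamental_theorem_of_calculus)
        (auto simp: has_real_derivative_iff_has_vector_derivative[symmetric]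
          intro!: derivative_eq_intros)
    have "I g t - I h t = integral {0..t} (\<lambda>s. exp (2 * k * s) *\<^sub>R (A s ** (g s - h s)))"
      unfolding I_def
      by (subst integral_diff[symmetric])
        (auto intro!: integrable_continuous_real contI0 simp: matrix_mult.diff_right scaleR_diff_right)
    also have "norm \<dots> \<le> integral {0..t} (\<lambda>s. k * dist g h * exp (2 * k * s))"
    proof (rule integral_norm_bound_integral)
      show "(\<lambda>s. exp (2 * k * s) *\<^sub>R (A s ** (g s - h s))) integrable_on {0..t}"
        using contI0[of t "g - h"] by (intro integrable_continuous_real) simp
      show "(\<lambda>s. k * dist g h * exp (2 * k * s)) integrable_on {0..t}"
        using int by blast
      fix s assume "s \<in> {0..t}"
      then have "norm (A s ** (g s - h s)) \<le> k * dist g h"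
        using Ak[of s] k dist_bounded[of g s h]
        by (intro order_trans[OF norm_matrix_mult_le] mult_mono) (auto simp: dist_norm)
      then show "norm (exp (2 * k * s) *\<^sub>R (A s ** (g s - h s))) \<le> k * dist g h * exp (2 * k * s)"
        by (simp add: mult.commute)
    qed
    also have "\<dots> = dist g h * exp (2 * k * t) / 2 - dist g h * exp (2 * k * 0) / 2"
      using int by (rule integral_unique)
    finally show ?thesis by (simp add: algebra_simps diff_divide_distrib)
  qed
  \<comment> \<open>The damped integral equation as a fixed point problem. Bounded continuous
    functions live on the whole line here, so negative times are frozen at 0.\<close>
  define F where "F g t = exp (- (2 * k * max t 0)) *\<^sub>R (mat 1 + I g (max t 0))" for g t
  have contF: "continuous_on UNIV (F g)" for g
  proof -
    have "continuous_on {0..} (I g)"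
      using derivI by (intro continuous_on_vector_derivative) auto
    then have "continuous_on UNIV (\<lambda>t. I g (max t 0))"
      by (rule continuous_on_compose2) (auto intro!: continuous_intros)
    then show ?thesis unfolding F_def by (intro continuous_intros)
  qed
  have lipF: "norm (F g t - F h t) \<le> 1/2 * dist g h" for g h t
  proof -
    let ?t = "max t 0"
    have "norm (F g t - F h t) = exp (- (2 * k * ?t)) * norm (I g ?t - I h ?t)"
      unfolding F_def by (simp add: scaleR_diff_right[symmetric])
    also have "\<dots> \<le> exp (- (2 * k * ?t)) * (dist g h * exp (2 * k * ?t) / 2)"
    proof (rule mult_left_mono)
      have "dist g h * (exp (2 * k * ?t) - 1) / 2 \<le> dist g h * exp (2 * k * ?t) / 2"
        by (intro divide_right_mono mult_left_mono) auto
      then show "norm (I g ?t - I h ?t) \<le> dist g h * exp (2 * k * ?t) / 2"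
        using normI[of ?t g h] by simp
    qed simp
    also have "\<dots> = 1/2 * dist g h" by (simp add: exp_minus)
    finally show ?thesis .
  qed
  have F0: "norm (F 0 t) \<le> norm (mat 1 :: real^'n^'n)" for t
    using k by (auto simp: F_def I_def mult_left_le_one_le)
  have "F g \<in> bcontfun" for g
  proof (rule bcontfun_normI[OF contF])
    show "norm (F g t) \<le> 1/2 * dist g 0 + norm (mat 1 :: real^'n^'n)" for t
      using lipF[of g t 0] F0[of t] norm_triangle_sub[of "F g t" "F 0 t"] by linarith
  qed
  then have appF: "apply_bcontfun (Bcontfun (F g)) = F g" for g
    by (simp add: Bcontfun_inverse)
  have "\<exists>!g. Bcontfun (F g) = g"
  proof (rule banach_fix_type[of "1/2"])
    show "\<forall>g h. dist (Bcontfun (F g)) (Bcontfun (F h)) \<le> 1/2 * dist g h"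
    proof (intro allI dist_bound)
      fix g h t
      show "dist (Bcontfun (F g) t) (Bcontfun (F h) t) \<le> 1/2 * dist g h"
        using lipF[of g t h] by (simp only: appF dist_norm[of "F g t"])
    qed
  qed auto
  then obtain g where "Bcontfun (F g) = g" by blast
  then have g: "apply_bcontfun g = F g" using appF by metis
  define M where "M t = mat 1 + I g t" for t
  have gM: "exp (2 * k * t) *\<^sub>R g t = M t" if "0 \<le> t" for t
    using that by (simp add: g F_def M_def exp_minus)
  have "(M has_vector_derivative A t ** M t) (at t within {0..})" if t: "0 \<le> t" for t
  proof -
    have "(M has_vector_derivative exp (2 * k * t) *\<^sub>R (A t ** g t)) (at t within {0..})"
      unfolding M_def using derivI[OF t] by (auto intro!: derivative_eq_intros)
    then show ?thesis by (simp add: gM[OF t, symmetric] matrix_mult.scaleR_right)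
  qed
  moreover have "M 0 = mat 1" by (simp add: M_def I_def)
  ultimately show ?thesis by blast
qed

subsection \<open>The cocycle of fundamental matrices\<close>

locale driven_system =
  fixes W :: "'w::metric_space set" and \<phi> :: "real \<Rightarrow> 'w \<Rightarrow> 'w" and X :: "'w \<Rightarrow> real^'d^'d"
  assumes compact_W: "compact W" and semiflow: "continuous_semiflow_on W \<phi>"
    and continuous_X: "continuous_on W X"
begin

abbreviation F :: "real \<Rightarrow> 'w \<Rightarrow> real^'d^'d" where
  "F \<equiv> fundamental_matrix \<phi> X"

lemma flow_in [simp]: "0 \<le> t \<Longrightarrow> w \<in> W \<Longrightarrow> \<phi> t w \<in> W"
  and flow_0 [simp]: "w \<in> W \<Longrightarrow> \<phi> 0 w = w"
  and flow_add: "0 \<le> s \<Longrightarrow> 0 \<le> t \<Longrightarrow> w \<in> W \<Longrightarrow> \<phi> (s + t) w = \<phi> s (\<phi> t w)"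
  and continuous_flow: "continuous_on ({0..} \<times> W) (\<lambda>(t, w). \<phi> t w)"
  using semiflow by (auto simp: continuous_semiflow_on_def)

lemma continuous_orbit: "w \<in> W \<Longrightarrow> S \<subseteq> {0..} \<Longrightarrow> continuous_on S (\<lambda>t. \<phi> t w)"
proof -
  assume *: "w \<in> W" "S \<subseteq> {0..}"
  have "continuous_on S (\<lambda>t. case (t, w) of (t, w) \<Rightarrow> \<phi> t w)"
    by (rule continuous_on_compose2[OF continuous_flow])
      (use * in \<open>auto intro!: continuous_on_Pair continuous_on_id continuous_on_const\<close>)
  then show ?thesis by simp
qed

lemma continuous_X_orbit: "w \<in> W \<Longrightarrow> S \<subseteq> {0..} \<Longrightarrow> continuous_on S (\<lambda>t. X (\<phi> t w))"
  by (rule continuous_on_compose2[OF continuous_X continuous_orbit]) auto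

lemma bound_X: obtains c where "0 < c" "\<And>w. w \<in> W \<Longrightarrow> norm (X w) \<le> c"
proof -
  have "bounded (X ` W)"
    using compact_W continuous_X by (intro compact_imp_bounded compact_continuous_image)
  then show thesis using that unfolding bounded_pos by auto
qed

lemma fundamental_matrix_eq:
  assumes "w \<in> W" "fundamental_solution \<phi> X w M" "0 \<le> t"
  shows "F t w = M t"
  unfolding fundamental_matrix_def
proof (rule the_equality)
  show "\<exists>M'. fundamental_solution \<phi> X w M' \<and> M t = M' t" using assms by blast
  obtain c where c: "\<And>w. w \<in> W \<Longrightarrow> norm (X w) \<le> c" using bound_X by blast
  fix A assume "\<exists>M'. fundamental_solution \<phi> X w M' \<and> A = M' t"
  then obtain M' where M': "fundamental_solution \<phi> X w M'" "A = M' t" by blast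
  have "M' t = M t"
    using assms M' c
    by (intro linear_ode_unique[of t M' "\<lambda>t. X (\<phi> t w)" M c])
      (auto simp: fundamental_solution_def intro: has_vector_derivative_within_subset)
  then show "A = M t" using M' by simp
qed

lemma fundamental_solution_F:
  assumes "w \<in> W"
  shows "fundamental_solution \<phi> X w (\<lambda>t. F t w)"
proof -
  obtain c where c: "\<And>w. w \<in> W \<Longrightarrow> norm (X w) \<le> c" using bound_X by blast
  have "\<exists>M. fundamental_solution \<phi> X w M"
    unfolding fundamental_solution_def
    by (rule linear_ode_exists[where c = c]) (use assms c continuous_X_orbit in auto)
  then obtain M where M: "fundamental_solution \<phi> X w M" by blast
  have eq: "F t w = M t" if "0 \<le> t" for t
    by (rule fundamental_matrix_eq[OF assms M that])
  show ?thesis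
    unfolding fundamental_solution_def
  proof (intro conjI allI impI)
    show "F 0 w = mat 1" using M eq by (simp add: fundamental_solution_def)
    fix t :: real assume t: "0 \<le> t"
    have "(M has_vector_derivative X (\<phi> t w) ** F t w) (at t within {0..})"
      using M t by (simp add: eq fundamental_solution_def)
    then show "((\<lambda>t. F t w) has_vector_derivative X (\<phi> t w) ** F t w) (at t within {0..})"
      using t by (auto intro: has_vector_derivative_transform[rotated 2] simp: eq)
  qed
qed

lemma F_0 [simp]: "w \<in> W \<Longrightarrow> F 0 w = mat 1"
  using fundamental_solution_F by (simp add: fundamental_solution_def)

lemma F_deriv:
  assumes "w \<in> W" "0 \<le> t" "S \<subseteq> {0..}"
  shows "((\<lambda>t. F t w) has_vector_derivative X (\<phi> t w) ** F t w) (at t within S)"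
  using fundamental_solution_F[OF assms(1)] assms(2,3)
  by (auto simp: fundamental_solution_def intro: has_vector_derivative_within_subset)

lemma F_unique:
  fixes M :: "real \<Rightarrow> real^'d^'d"
  assumes w: "w \<in> W" and T: "0 \<le> T"
    and M: "\<And>t. 0 \<le> t \<Longrightarrow> t \<le> T \<Longrightarrow> (M has_vector_derivative X (\<phi> t w) ** M t) (at t within {0..T})"
  shows "M T = F T w ** M 0"
proof -
  obtain c where c: "\<And>w. w \<in> W \<Longrightarrow> norm (X w) \<le> c" using bound_X by blast
  show ?thesis
  proof (rule linear_ode_unique[where A = "\<lambda>t. X (\<phi> t w)" and c = c and M = M
        and M' = "\<lambda>t. F t w ** M 0"])
    show "((\<lambda>t. F t w ** M 0) has_vector_derivative X (\<phi> t w) ** (F t w ** M 0)) (at t within {0..T})"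
      if "0 \<le> t" "t \<le> T" for t
      using matrix_mult.has_vector_derivative[OF F_deriv[OF w, of t "{0..T}"] has_vector_derivative_const[of "M 0"]] that
      by (simp add: matrix_mul_assoc)
  qed (use w T M c in auto)
qed

text \<open>The shifted solution solves the equation along the orbit of \<open>\<phi> t w\<close>,
  with initial value \<open>F t w\<close>.\<close>

lemma F_cocycle:
  assumes w: "w \<in> W" and s: "0 \<le> s" and t: "0 \<le> t"
  shows "F (s + t) w = F s (\<phi> t w) ** F t w"
proof -
  have "(\<lambda>r. F (r + t) w) s = F s (\<phi> t w) ** (\<lambda>r. F (r + t) w) 0"
  proof (rule F_unique)
    fix r assume r: "0 \<le> r" "r \<le> s"
    have "((\<lambda>t. F t w) has_vector_derivative X (\<phi> (r + t) w) ** F (r + t) w)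
      (at (r + t) within (\<lambda>r. r + t) ` {0..s})"
      using w r t by (intro F_deriv) auto
    then have "((\<lambda>t. F t w) \<circ> (\<lambda>r. r + t) has_vector_derivative 1 *\<^sub>R (X (\<phi> (r + t) w) ** F (r + t) w))
      (at r within {0..s})"
      by (intro vector_diff_chain_within) (auto intro!: derivative_eq_intros)
    then show "((\<lambda>r. F (r + t) w) has_vector_derivative X (\<phi> r (\<phi> t w)) ** F (r + t) w) (at r within {0..s})"
      using w r t by (simp add: flow_add o_def)
  qed (use assms in auto)
  then show ?thesis by simp
qed

lemma F_growth:
  assumes c: "\<And>w. w \<in> W \<Longrightarrow> norm (X w) \<le> c" and "w \<in> W" "0 \<le> t"
  shows "norm (F t w) \<le> CARD('d) * ode_growth c t"
proof -
  have "norm (F t w) \<le> norm (F 0 w) * ode_growth c t"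
    using assms by (intro linear_ode_growth[where A = "\<lambda>t. X (\<phi> t w)"] F_deriv) auto
  also have "\<dots> \<le> CARD('d) * ode_growth c t"
    using assms norm_mat_1_le[where 'n='d] by (intro mult_right_mono) (auto simp: ode_growth_def)
  finally show ?thesis .
qed

lemma F_bound:
  obtains m where "1 \<le> m" "\<And>t w. w \<in> W \<Longrightarrow> 0 \<le> t \<Longrightarrow> t \<le> T \<Longrightarrow> norm (F t w) \<le> m"
proof -
  obtain c where c: "0 < c" "\<And>w. w \<in> W \<Longrightarrow> norm (X w) \<le> c" using bound_X by blast
  show thesis
  proof
    show "1 \<le> max 1 (CARD('d) * ode_growth c T)" by simp
    fix t w assume "w \<in> W" "0 \<le> t" "t \<le> T"
    then have "norm (F t w) \<le> CARD('d) * ode_growth c t" using F_growth c by blast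
    also have "\<dots> \<le> CARD('d) * ode_growth c T"
      using \<open>0 \<le> t\<close> \<open>t \<le> T\<close> c by (intro mult_left_mono ode_growth_mono) auto
    finally show "norm (F t w) \<le> max 1 (CARD('d) * ode_growth c T)" by simp
  qed
qed

text \<open>By compactness the coefficients along two nearby orbits are close uniformly on [0, T],
  so the perturbation estimate applies with one constant.\<close>

lemma continuous_F:
  assumes T: "0 \<le> T"
  shows "continuous_on W (F T)"
proof -
  obtain c where c: "0 < c" "\<And>w. w \<in> W \<Longrightarrow> norm (X w) \<le> c" using bound_X by blast
  obtain m where m: "1 \<le> m" "\<And>t w. w \<in> W \<Longrightarrow> 0 \<le> t \<Longrightarrow> t \<le> T \<Longrightarrow> norm (F t w) \<le> m"
    using F_bound[of T] by blast
  define K where "K = m * sqrt (T * ode_growth c T)"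
  have K: "0 \<le> K" using m T by (simp add: K_def ode_growth_def)
  have "continuous_on ({0..T} \<times> W) (\<lambda>(t, w). X (\<phi> t w))"
    unfolding case_prod_beta
  proof (rule continuous_on_compose2[OF continuous_X])
    show "continuous_on ({0..T} \<times> W) (\<lambda>p. \<phi> (fst p) (snd p))"
      by (rule continuous_on_subset[OF continuous_flow[unfolded case_prod_beta]]) auto
  qed auto
  then have unif: "uniformly_continuous_on ({0..T} \<times> W) (\<lambda>(t, w). X (\<phi> t w))"
    using compact_W by (intro compact_uniformly_continuous compact_Times) auto
  show ?thesis
    unfolding continuous_on_iff
  proof (intro ballI allI impI)
    fix w and e :: real assume w: "w \<in> W" and e: "0 < e"
    define e' where "e' = e / (K + 1)"
    have e': "0 < e'" using e K by (simp add: e'_def)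
    then obtain d where d: "0 < d" and dd: "\<And>p q. p \<in> {0..T} \<times> W \<Longrightarrow> q \<in> {0..T} \<times> W \<Longrightarrow> dist p q < d \<Longrightarrow>
        dist (case p of (t, w) \<Rightarrow> X (\<phi> t w)) (case q of (t, w) \<Rightarrow> X (\<phi> t w)) < e'"
      using unif unfolding uniformly_continuous_on_def by blast
    show "\<exists>d>0. \<forall>v\<in>W. dist v w < d \<longrightarrow> dist (F T v) (F T w) < e"
    proof (intro exI conjI ballI impI)
      fix v assume v: "v \<in> W" and "dist v w < d"
      then have "norm (X (\<phi> t v) - X (\<phi> t w)) \<le> e'" if "0 \<le> t" "t \<le> T" for t
        using dd[of "(t, v)" "(t, w)"] w that by (auto simp: dist_Pair_Pair dist_norm)
      then have "norm (F T v - F T w) \<le> e' * K"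
        unfolding K_def using v w T c m
        by (intro linear_ode_perturbation[where A = "\<lambda>t. X (\<phi> t v)" and B = "\<lambda>t. X (\<phi> t w)"] F_deriv) auto
      also have "\<dots> < e" using e K by (simp add: e'_def field_simps)
      finally show "dist (F T v) (F T w) < e" by (simp add: dist_norm)
    qed (rule d)
  qed
qed

text \<open>From each point of U the solution is halved after a waiting time that depends on the
  point but is at most b. Chaining the waiting times gives about \<open>\<tau> / b\<close> halvings;
  the factor \<open>2 * m\<close> covers the unfinished last wait.\<close>

lemma F_decay_along_segment:
  assumes U: "\<And>u. u \<in> U \<Longrightarrow> \<exists>T. 1 \<le> T \<and> T \<le> b \<and> norm (F T u) \<le> 1/2"
    and m: "\<And>t w. w \<in> W \<Longrightarrow> 0 \<le> t \<Longrightarrow> t \<le> b \<Longrightarrow> norm (F t w) \<le> m" "0 \<le> m"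
    and b: "1 \<le> b"
    and w: "w \<in> W" "\<And>t. 0 \<le> t \<Longrightarrow> t \<le> \<tau> \<Longrightarrow> \<phi> t w \<in> U" and \<tau>: "0 \<le> \<tau>"
  shows "norm (F \<tau> w) \<le> 2 * m * (1/2) powr (\<tau> / b)"
proof -
  \<comment> \<open>Induction on an integer bound for \<tau>, which drops by 1 with each waiting
    time because these are at least 1.\<close>
  have "\<tau> \<le> real n \<Longrightarrow> ?thesis" for n
    using w \<tau>
  proof (induction n arbitrary: w \<tau> rule: less_induct)
    case (less n)
    show ?case
    proof (cases "\<tau> \<le> b")
      case True
      have "norm (F \<tau> w) \<le> m" using less.prems True m by blast
      moreover have "(1/2::real) powr 1 \<le> (1/2) powr (\<tau> / b)"
        using True b by (intro powr_mono') (auto simp: field_simps)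
      then have "2 * m * (1/2) \<le> 2 * m * (1/2) powr (\<tau> / b)"
        using m(2) by (intro mult_left_mono) auto
      ultimately show ?thesis by simp
    next
      case False
      have "w \<in> U" using less.prems(3)[of 0] less.prems by simp
      then obtain T where T: "1 \<le> T" "T \<le> b" "norm (F T w) \<le> 1/2" using U by blast
      have n: "0 < n" using less.prems False b by (cases n) auto
      have "norm (F (\<tau> - T) (\<phi> T w)) \<le> 2 * m * (1/2) powr ((\<tau> - T) / b)"
      proof (rule less.IH[of "n - 1"])
        show "n - 1 < n" using n by simp
        show "\<tau> - T \<le> real (n - 1)" using less.prems(1) T n by simp
        show "\<phi> T w \<in> W" using less.prems T by simp
        show "0 \<le> \<tau> - T" using False T by simp
        show "\<phi> t (\<phi> T w) \<in> U" if "0 \<le> t" "t \<le> \<tau> - T" for t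
          using less.prems(3)[of "t + T"] flow_add[of t T w] less.prems(2) that T by simp
      qed
      moreover have "F \<tau> w = F (\<tau> - T) (\<phi> T w) ** F T w"
        using F_cocycle[of w "\<tau> - T" T] less.prems(2) False T by simp
      then have "norm (F \<tau> w) \<le> norm (F (\<tau> - T) (\<phi> T w)) * norm (F T w)"
        by (simp only: norm_matrix_mult_le)
      ultimately have "norm (F \<tau> w) \<le> (2 * m * (1/2) powr ((\<tau> - T) / b)) * (1/2)"
        using T(3) m(2) by (elim order_trans) (intro mult_mono, auto)
      also have "\<dots> = 2 * m * ((1/2) powr ((\<tau> - T) / b) * (1/2) powr 1)" by simp
      also have "\<dots> = 2 * m * (1/2) powr ((\<tau> - T) / b + 1)" by (simp only: powr_add)
      also have "\<dots> \<le> 2 * m * (1/2) powr (\<tau> / b)"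
      proof -
        have "(1/2::real) powr ((\<tau> - T) / b + 1) \<le> (1/2) powr (\<tau> / b)"
          using T b by (intro powr_mono') (auto simp: field_simps)
        then show ?thesis using m(2) by (intro mult_left_mono) auto
      qed
      finally show ?thesis .
    qed
  qed
  then show ?thesis using real_arch_simple by blast
qed

end

subsection \<open>Comparison of the induced norm with the Euclidean matrix norm\<close>

text \<open>The upper bound comes from expanding in the standard basis. It makes N Lipschitz, so N
  has a positive minimum on the unit sphere, which is the lower constant.\<close>

lemma vector_norm_equiv_norm:
  fixes N :: "real^'d \<Rightarrow> real"
  assumes N: "vector_norm N"
  obtains a b where "0 < a" "0 < b" "\<And>x. a * norm x \<le> N x" "\<And>x. N x \<le> b * norm x"
proof -
  have nonneg: "0 \<le> N x" and zero: "N x = 0 \<longleftrightarrow> x = 0"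
    and scale: "N (c *\<^sub>R x) = \<bar>c\<bar> * N x" and tri: "N (x + y) \<le> N x + N y" for x y c
    using N by (auto simp: vector_norm_def)
  define b where "b = (\<Sum>i\<in>UNIV. N (axis i (1::real))) + 1"
  have b: "0 < b" using nonneg by (auto simp: b_def intro!: add_nonneg_pos sum_nonneg)
  have upper: "N x \<le> b * norm x" for x
  proof -
    have N0: "N 0 = 0" using zero by simp
    have sum_le: "N (\<Sum>i\<in>I. f i) \<le> (\<Sum>i\<in>I. N (f i))" if "finite I" for I :: "'d set" and f
      using that by (induction I rule: finite_induct) (auto simp: N0 intro: order_trans[OF tri])
    have "N x = N (\<Sum>i\<in>UNIV. (x $ i) *\<^sub>R axis i 1)"
      using basis_expansion[of x] by (simp add: scalar_mult_eq_scaleR)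
    also have "\<dots> \<le> (\<Sum>i\<in>UNIV. \<bar>x $ i\<bar> * N (axis i 1))"
      using sum_le[of UNIV "\<lambda>i. (x $ i) *\<^sub>R axis i 1"] by (simp add: scale)
    also have "\<dots> \<le> (\<Sum>i\<in>UNIV. norm x * N (axis i 1))"
      by (intro sum_mono mult_right_mono component_le_norm_cart nonneg)
    also have "\<dots> \<le> b * norm x"
      by (simp add: b_def sum_distrib_left[symmetric] algebra_simps)
    finally show ?thesis .
  qed
  have "b-lipschitz_on UNIV N"
  proof (rule lipschitz_onI)
    fix x y
    have "N x \<le> N (x - y) + N y" "N y \<le> N (y - x) + N x"
      using tri[of "x - y" y] tri[of "y - x" x] by auto
    moreover have "N (x - y) \<le> b * norm (x - y)" "N (y - x) \<le> b * norm (x - y)"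
      using upper[of "x - y"] upper[of "y - x"] by (auto simp: norm_minus_commute)
    ultimately show "dist (N x) (N y) \<le> b * dist x y"
      by (auto simp: dist_norm)
  qed (use b in simp)
  then have "continuous_on (sphere 0 1) N"
    using lipschitz_on_continuous_on continuous_on_subset by blast
  moreover have "sphere 0 1 \<noteq> ({} :: (real^'d) set)" by simp
  ultimately obtain x0 :: "real^'d" where "x0 \<in> sphere 0 1" "\<forall>x\<in>sphere 0 1. N x0 \<le> N x"
    using continuous_attains_inf[OF compact_sphere, of "0::real^'d" 1 N] by blast
  then have x0: "norm x0 = 1" "\<And>x. norm x = 1 \<Longrightarrow> N x0 \<le> N x" by simp_all
  have "x0 \<noteq> 0" using x0(1) by force
  then have a: "0 < N x0" using nonneg[of x0] zero[of x0] by linarith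
  have "N x0 * norm x \<le> N x" for x
  proof (cases "x = 0")
    case False
    have "N x0 \<le> N ((1 / norm x) *\<^sub>R x)" using False by (intro x0(2)) simp
    then show ?thesis using False by (simp add: scale field_simps)
  qed (simp add: nonneg)
  then show thesis using that[OF a b] upper by blast
qed

text \<open>Comparability of N with the Euclidean norm bounds all quotients, so the supremum is a
  genuine one; testing on basis vectors recovers the entries of A.\<close>

lemma induced_norm_equiv_norm:
  fixes N :: "real^'d \<Rightarrow> real"
  assumes N: "vector_norm N"
  obtains c where "0 < c" "\<And>A. induced_norm N A \<le> c * norm A" "\<And>A. norm A \<le> c * induced_norm N A"
proof -
  obtain a b where ab: "0 < a" "0 < b" "\<And>x. a * norm x \<le> N x" "\<And>x. N x \<le> b * norm x"
    using vector_norm_equiv_norm[OF N] by blast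
  define c where "c = b / a"
  have c: "0 < c" using ab by (simp add: c_def)
  have pos: "0 < N x" if "x \<noteq> 0" for x
  proof -
    have "0 < a * norm x" using ab(1) that by simp
    then show ?thesis using ab(3)[of x] by linarith
  qed
  have quot: "N (A *v x) / N x \<le> c * norm A" for A x
  proof (cases "x = 0")
    case True
    then have "N x = 0" using N by (simp add: vector_norm_def)
    then show ?thesis using c by simp
  next
    case False
    have "N (A *v x) \<le> b * norm (A *v x)" by (rule ab)
    also have "\<dots> \<le> b * (norm A * norm x)"
      using ab(2) by (intro mult_left_mono norm_matrix_vector_mult_le) auto
    also have "\<dots> = c * norm A * (a * norm x)" using ab by (simp add: c_def)
    also have "\<dots> \<le> c * norm A * N x" using ab(3) c by (intro mult_left_mono) auto
    finally show ?thesis using pos[OF False] by (simp add: field_simps)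
  qed
  have "induced_norm N A \<le> c * norm A" for A
    unfolding induced_norm_def using quot by (intro cSUP_least) auto
  have "norm A \<le> CARD('d) * CARD('d) * c * induced_norm N A" for A
  proof -
    have "\<bar>A $ i $ j\<bar> \<le> c * induced_norm N A" for i j
    proof -
      let ?e = "axis j (1::real)"
      have "?e \<noteq> 0" by (simp add: axis_eq_0_iff)
      have "bdd_above (range (\<lambda>x. N (A *v x) / N x))"
        using quot by (intro bdd_aboveI) auto
      then have "N (A *v ?e) / N ?e \<le> induced_norm N A"
        unfolding induced_norm_def by (rule cSUP_upper[rotated]) simp
      then have le: "N (A *v ?e) \<le> induced_norm N A * N ?e"
        using pos[OF \<open>?e \<noteq> 0\<close>] by (simp add: field_simps)
      have "0 \<le> N (A *v ?e)" using N by (simp add: vector_norm_def)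
      then have "0 \<le> induced_norm N A * N ?e" using le by (rule order_trans)
      then have ind: "0 \<le> induced_norm N A"
        using pos[OF \<open>?e \<noteq> 0\<close>] by (simp add: zero_le_mult_iff)
      have "A $ i $ j = (A *v ?e) $ i" by (simp add: matrix_vector_mul_component inner_axis)
      then have "a * \<bar>A $ i $ j\<bar> \<le> a * norm (A *v ?e)"
        using ab component_le_norm_cart[of "A *v ?e" i] by (intro mult_left_mono) auto
      also have "\<dots> \<le> N (A *v ?e)" by (rule ab)
      also note le
      also have "induced_norm N A * N ?e \<le> induced_norm N A * b"
        using ab(4)[of ?e] ind by (intro mult_left_mono) (auto simp: norm_axis_1)
      finally show ?thesis using ab by (simp add: c_def field_simps)
    qed
    then have "(\<Sum>i\<in>UNIV. \<Sum>j\<in>UNIV. \<bar>A $ i $ j\<bar>) \<le> (\<Sum>i\<in>(UNIV::'d set). \<Sum>j\<in>(UNIV::'d set). c * induced_norm N A)"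
      by (intro sum_mono)
    then show ?thesis using norm_matrix_le_sum_entries[of A] by simp
  qed
  define C where "C = CARD('d) * CARD('d) * c"
  have "c \<le> C"
  proof -
    have "1 \<le> real CARD('d)" by (simp add: Suc_le_eq)
    then have "1 * 1 \<le> real CARD('d) * real CARD('d)" by (intro mult_mono) auto
    then have "1 * c \<le> real CARD('d) * real CARD('d) * c"
      using c by (intro mult_right_mono) auto
    then show ?thesis by (simp add: C_def)
  qed
  show thesis
  proof
    show "0 < C" using c \<open>c \<le> C\<close> by simp
    show "induced_norm N A \<le> C * norm A" for A
      using \<open>induced_norm N A \<le> c * norm A\<close> mult_right_mono[OF \<open>c \<le> C\<close>, of "norm A"] by simp
    show "norm A \<le> C * induced_norm N A" for A
      using \<open>norm A \<le> CARD('d) * CARD('d) * c * induced_norm N A\<close> by (simp add: C_def)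
  qed
qed

text \<open>The supremum is only conditionally defined: compactness and continuity make the range
  bounded for the first estimate, and \<open>W \<noteq> {}\<close> is required for the
  second.\<close>

lemma sup_norm_on_equiv_norm:
  fixes N :: "real^'d \<Rightarrow> real" and W :: "'w::metric_space set"
  assumes N: "vector_norm N" and W: "compact W"
  obtains c where "0 < c"
    "\<And>Z w. continuous_on W Z \<Longrightarrow> w \<in> W \<Longrightarrow> norm (Z w) \<le> c * sup_norm_on N W Z"
    "\<And>Z e. W \<noteq> {} \<Longrightarrow> (\<And>w. w \<in> W \<Longrightarrow> norm (Z w) \<le> e) \<Longrightarrow> sup_norm_on N W Z \<le> c * e"
proof -
  obtain c where c: "0 < c" "\<And>A. induced_norm N A \<le> c * norm A" "\<And>A. norm A \<le> c * induced_norm N A"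
    using induced_norm_equiv_norm[OF N] by blast
  show thesis
  proof (rule that[OF c(1)])
    fix Z :: "'w \<Rightarrow> real^'d^'d" and e assume "W \<noteq> {}" "\<And>w. w \<in> W \<Longrightarrow> norm (Z w) \<le> e"
    then show "sup_norm_on N W Z \<le> c * e"
      unfolding sup_norm_on_def using c
      by (intro cSUP_least order_trans[OF c(2)] mult_left_mono) auto
  next
    fix Z :: "'w \<Rightarrow> real^'d^'d" and w assume Z: "continuous_on W Z" and w: "w \<in> W"
    have "bounded (Z ` W)"
      using W Z by (intro compact_imp_bounded compact_continuous_image)
    then obtain b where b: "\<And>w. w \<in> W \<Longrightarrow> norm (Z w) \<le> b"
      unfolding bounded_iff by auto
    have "bdd_above ((\<lambda>w. induced_norm N (Z w)) ` W)"
    proof (rule bdd_aboveI2)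
      show "induced_norm N (Z w) \<le> c * b" if "w \<in> W" for w
        using b[OF that] c by (intro order_trans[OF c(2)] mult_left_mono) auto
    qed
    then have "induced_norm N (Z w) \<le> sup_norm_on N W Z"
      unfolding sup_norm_on_def using w by (intro cSUP_upper)
    then show "norm (Z w) \<le> c * sup_norm_on N W Z"
      using c by (intro order_trans[OF c(3)] mult_left_mono) auto
  qed
qed

subsection \<open>Stability under small perturbations\<close>

context driven_system
begin

text \<open>Stability in the library norm on matrices, so that N enters only through norm
  equivalence.\<close>

definition exponentially_decaying :: bool where
  "exponentially_decaying \<longleftrightarrow>
     (\<exists>C \<gamma>. 0 < C \<and> 0 < \<gamma> \<and> \<gamma> < 1 \<and> (\<forall>t\<ge>0. \<forall>w\<in>W. norm (F t w) \<le> C * \<gamma> powr t))"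

lemma uniformly_exponentially_stable_iff:
  assumes N: "vector_norm N"
  shows "uniformly_exponentially_stable N W \<phi> X \<longleftrightarrow> exponentially_decaying"
proof -
  obtain c where c: "0 < c" "\<And>A. induced_norm N A \<le> c * norm A" "\<And>A. norm A \<le> c * induced_norm N A"
    using induced_norm_equiv_norm[OF N] by blast
  show ?thesis
  proof
    assume "uniformly_exponentially_stable N W \<phi> X"
    then obtain C \<gamma> where C: "0 < C" "0 < \<gamma>" "\<gamma> < 1"
      "\<And>t w. 0 \<le> t \<Longrightarrow> w \<in> W \<Longrightarrow> induced_norm N (F t w) \<le> C * \<gamma> powr t"
      unfolding uniformly_exponentially_stable_def by blast
    have "norm (F t w) \<le> (c * C) * \<gamma> powr t" if "0 \<le> t" "w \<in> W" for t w
      using order_trans[OF c(3) mult_left_mono[OF C(4)[OF that]]] c(1) by (simp add: mult.assoc)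
    then show exponentially_decaying
      unfolding exponentially_decaying_def using C c(1) by (intro exI[of _ "c * C"] exI[of _ \<gamma>]) auto
  next
    assume exponentially_decaying
    then obtain C \<gamma> where C: "0 < C" "0 < \<gamma>" "\<gamma> < 1"
      "\<And>t w. 0 \<le> t \<Longrightarrow> w \<in> W \<Longrightarrow> norm (F t w) \<le> C * \<gamma> powr t"
      unfolding exponentially_decaying_def by blast
    have "induced_norm N (F t w) \<le> (c * C) * \<gamma> powr t" if "0 \<le> t" "w \<in> W" for t w
      using order_trans[OF c(2) mult_left_mono[OF C(4)[OF that]]] c(1) by (simp add: mult.assoc)
    then show "uniformly_exponentially_stable N W \<phi> X"
      unfolding uniformly_exponentially_stable_def using C c(1)
      by (intro exI[of _ "c * C"] exI[of _ \<gamma>]) auto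
  qed
qed

lemma half_powr_div: "0 < b \<Longrightarrow> (1/2::real) powr (t / b) = ((1/2) powr (1 / b)) powr t"
  by (simp add: powr_powr)

text \<open>This reduces uniform stability to one inequality at one finite time, a form that
  survives perturbation and is the target of the converse as well.\<close>

lemma exponentially_decaying_if_contraction:
  assumes T: "1 \<le> T" and half: "\<And>w. w \<in> W \<Longrightarrow> norm (F T w) \<le> 1/2"
  shows exponentially_decaying
proof -
  obtain m where m: "1 \<le> m" "\<And>t w. w \<in> W \<Longrightarrow> 0 \<le> t \<Longrightarrow> t \<le> T \<Longrightarrow> norm (F t w) \<le> m"
    using F_bound[of T] by blast
  have "norm (F t w) \<le> (2 * m) * ((1/2) powr (1 / T)) powr t" if "0 \<le> t" "w \<in> W" for t w
  proof -
    have "norm (F t w) \<le> 2 * m * (1/2) powr (t / T)"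
      by (rule F_decay_along_segment[where U = W]) (use T half m that in auto)
    then show ?thesis using T half_powr_div[of T t] by simp
  qed
  moreover have "(1/2::real) powr (1 / T) < 1"
    using T powr01_less_one[of "1/2" "1/T"] by simp
  ultimately show ?thesis
    unfolding exponentially_decaying_def using m(1)
    by (intro exI[of _ "2 * m"] exI[of _ "(1/2) powr (1 / T)"]) auto
qed

lemma exponentially_decaying_contraction:
  assumes exponentially_decaying and "0 < e"
  obtains T where "1 \<le> T" "\<And>w. w \<in> W \<Longrightarrow> norm (F T w) \<le> e"
proof -
  obtain C \<gamma> where C: "0 < C" "0 < \<gamma>" "\<gamma> < 1"
    "\<And>t w. 0 \<le> t \<Longrightarrow> w \<in> W \<Longrightarrow> norm (F t w) \<le> C * \<gamma> powr t"
    using assms unfolding exponentially_decaying_def by blast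
  obtain n where n: "\<gamma> ^ n < e / C"
    using real_arch_pow_inv[of "e / C" \<gamma>] C \<open>0 < e\<close> by auto
  have "norm (F (real (Suc n)) w) \<le> e" if "w \<in> W" for w
  proof -
    have "norm (F (real (Suc n)) w) \<le> C * \<gamma> powr (real (Suc n))"
      using that by (intro C(4)) auto
    also have "\<dots> = C * \<gamma> ^ Suc n" using C by (simp only: powr_realpow)
    also have "\<dots> \<le> C * \<gamma> ^ n" using C by (intro mult_left_mono power_decreasing) auto
    also have "\<dots> \<le> e" using n C by (simp add: field_simps)
    finally show ?thesis .
  qed
  then show thesis by (intro that[of "real (Suc n)"]) auto
qed

lemma F_perturbation:
  assumes T: "0 \<le> T" and e: "0 < e"
  obtains \<epsilon> where "0 < \<epsilon>"
    "\<And>Y w. continuous_on W Y \<Longrightarrow> (\<And>w. w \<in> W \<Longrightarrow> norm (X w - Y w) \<le> \<epsilon>) \<Longrightarrow> w \<in> W \<Longrightarrow>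
      norm (F T w - fundamental_matrix \<phi> Y T w) \<le> e"
proof -
  obtain c where c: "0 < c" "\<And>w. w \<in> W \<Longrightarrow> norm (X w) \<le> c" using bound_X by blast
  obtain m where m: "1 \<le> m" "\<And>t w. w \<in> W \<Longrightarrow> 0 \<le> t \<Longrightarrow> t \<le> T \<Longrightarrow> norm (F t w) \<le> m"
    using F_bound[of T] by blast
  \<comment> \<open>Capping \<epsilon> at 1 bounds every admissible Y by \<open>c + 1\<close>, so K
    can be fixed before \<epsilon>.\<close>
  define K where "K = m * sqrt (T * ode_growth (c + 1) T)"
  have K: "0 \<le> K" using m T by (simp add: K_def ode_growth_def)
  define \<epsilon> where "\<epsilon> = min 1 (e / (K + 1))"
  have \<epsilon>: "0 < \<epsilon>" "\<epsilon> \<le> 1" "\<epsilon> * K \<le> e"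
  proof -
    show "0 < \<epsilon>" "\<epsilon> \<le> 1" using e K by (auto simp: \<epsilon>_def)
    have "\<epsilon> * K \<le> e / (K + 1) * K" using K by (intro mult_right_mono) (auto simp: \<epsilon>_def)
    also have "\<dots> \<le> e" using e K by (simp add: field_simps)
    finally show "\<epsilon> * K \<le> e" .
  qed
  show thesis
  proof (rule that[OF \<epsilon>(1)])
    fix Y w assume Y: "continuous_on W Y" "\<And>w. w \<in> W \<Longrightarrow> norm (X w - Y w) \<le> \<epsilon>" and w: "w \<in> W"
    interpret Y: driven_system W \<phi> Y
      using compact_W semiflow Y by unfold_locales
    have Yc: "norm (Y w) \<le> c + 1" if "w \<in> W" for w
      using c(2)[OF that] Y(2)[OF that] \<epsilon>(2) norm_triangle_sub[of "Y w" "X w"]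
      by (simp add: norm_minus_commute)
    have "norm (Y.F T w - F T w) \<le> \<epsilon> * K"
      unfolding K_def
      by (rule linear_ode_perturbation[where A = "\<lambda>t. Y (\<phi> t w)" and B = "\<lambda>t. X (\<phi> t w)"])
        (use T w m Yc Y(2) in \<open>auto intro!: F_deriv Y.F_deriv simp: norm_minus_commute\<close>)
    then show "norm (F T w - Y.F T w) \<le> e" using \<epsilon> by (simp add: norm_minus_commute)
  qed
qed

text \<open>X contracts to 1/4 at time T, and a small perturbation adds at most another 1/4. So Y
  still contracts to 1/2 and decays uniformly at all points, periodic or not.\<close>

lemma exponentially_decaying_imp_robust:
  assumes N: "vector_norm N" and exponentially_decaying
  shows "robustly_periodically_stable N W \<phi> X"
proof -
  obtain T where T: "1 \<le> T" "\<And>w. w \<in> W \<Longrightarrow> norm (F T w) \<le> 1/4"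
    using exponentially_decaying_contraction[OF assms(2), of "1/4"] by auto
  obtain \<epsilon> where \<epsilon>: "0 < \<epsilon>"
    "\<And>Y w. continuous_on W Y \<Longrightarrow> (\<And>w. w \<in> W \<Longrightarrow> norm (X w - Y w) \<le> \<epsilon>) \<Longrightarrow> w \<in> W \<Longrightarrow>
      norm (F T w - fundamental_matrix \<phi> Y T w) \<le> 1/4"
    using F_perturbation[of T "1/4"] T by auto
  obtain c where c: "0 < c"
    "\<And>Z w. continuous_on W Z \<Longrightarrow> w \<in> W \<Longrightarrow> norm (Z w :: real^'d^'d) \<le> c * sup_norm_on N W Z"
    using sup_norm_on_equiv_norm[OF N compact_W] by metis
  show ?thesis
    unfolding robustly_periodically_stable_def
  proof (rule exI[of _ "\<epsilon> / c"], intro conjI allI impI)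
    show "0 < \<epsilon> / c" using \<epsilon> c by simp
    fix Y p assume Y: "continuous_on W Y \<and> sup_norm_on N W (\<lambda>w. X w - Y w) < \<epsilon> / c"
      and p: "periodic_point W \<phi> p"
    interpret Y: driven_system W \<phi> Y
      using compact_W semiflow Y by unfold_locales auto
    have XY: "norm (X w - Y w) \<le> \<epsilon>" if "w \<in> W" for w
    proof -
      have "norm (X w - Y w) \<le> c * sup_norm_on N W (\<lambda>w. X w - Y w)"
        using c(2)[of "\<lambda>w. X w - Y w"] that Y continuous_X by (auto intro: continuous_intros)
      also have "\<dots> \<le> c * (\<epsilon> / c)" using Y c(1) by (intro mult_left_mono) auto
      finally show ?thesis using c(1) by simp
    qed
    have half: "norm (Y.F T w) \<le> 1/2" if "w \<in> W" for w
      using \<epsilon>(2)[OF _ XY that] Y T(2)[OF that] norm_triangle_sub[of "Y.F T w" "F T w"]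
      by (simp add: norm_minus_commute)
    have "Y.exponentially_decaying"
      by (rule Y.exponentially_decaying_if_contraction[OF T(1)]) (rule half)
    then have "uniformly_exponentially_stable N W \<phi> Y"
      using Y.uniformly_exponentially_stable_iff[OF N] by simp
    then show "\<exists>K \<gamma>. 0 < K \<and> 0 < \<gamma> \<and> \<gamma> < 1 \<and> (\<forall>t\<ge>0. induced_norm N (Y.F t p) \<le> K * \<gamma> powr t)"
      using p unfolding uniformly_exponentially_stable_def periodic_point_def by blast
  qed
qed

text \<open>The converse uses only convergence to 0 at periodic points, so the rates are dropped and
  closeness becomes a pointwise bound. Halving e turns a non-strict bound into the strict one of the
  definition.\<close>

lemma robust_imp_tendsto_0:
  assumes N: "vector_norm N" and robust: "robustly_periodically_stable N W \<phi> X"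
  obtains \<epsilon> where "0 < \<epsilon>"
    "\<And>Y p. continuous_on W Y \<Longrightarrow> (\<And>w. w \<in> W \<Longrightarrow> norm (X w - Y w) \<le> \<epsilon>) \<Longrightarrow>
       periodic_point W \<phi> p \<Longrightarrow> ((\<lambda>t. fundamental_matrix \<phi> Y t p) \<longlongrightarrow> 0) at_top"
proof -
  obtain e where e: "0 < e"
    "\<And>Y p. continuous_on W Y \<Longrightarrow> sup_norm_on N W (\<lambda>w. X w - Y w) < e \<Longrightarrow> periodic_point W \<phi> p \<Longrightarrow>
      \<exists>K \<gamma>. K > 0 \<and> 0 < \<gamma> \<and> \<gamma> < 1 \<and>
              (\<forall>t\<ge>0. induced_norm N (fundamental_matrix \<phi> Y t p) \<le> K * \<gamma> powr t)"
    using robust unfolding robustly_periodically_stable_def by blast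
  obtain c where c: "0 < c" "\<And>A. norm (A :: real^'d^'d) \<le> c * induced_norm N A"
    using induced_norm_equiv_norm[OF N] by metis
  obtain c' where c': "0 < c'"
    "\<And>Z e. W \<noteq> {} \<Longrightarrow> (\<And>w. w \<in> W \<Longrightarrow> norm (Z w :: real^'d^'d) \<le> e) \<Longrightarrow> sup_norm_on N W Z \<le> c' * e"
    using sup_norm_on_equiv_norm[OF N compact_W] by metis
  show thesis
  proof (rule that[of "e / (2 * c')"])
    show "0 < e / (2 * c')" using e c' by simp
    fix Y p assume Y: "continuous_on W Y" "\<And>w. w \<in> W \<Longrightarrow> norm (X w - Y w) \<le> e / (2 * c')"
      and p: "periodic_point W \<phi> p"
    have "W \<noteq> {}" using p by (auto simp: periodic_point_def)
    then have "sup_norm_on N W (\<lambda>w. X w - Y w) \<le> c' * (e / (2 * c'))"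
      using Y(2) by (rule c'(2))
    also have "\<dots> < e" using c' e by simp
    finally obtain K \<gamma> where K: "K > 0" "0 < \<gamma>" "\<gamma> < 1"
      "\<And>t. t\<ge>0 \<Longrightarrow> induced_norm N (fundamental_matrix \<phi> Y t p) \<le> K * \<gamma> powr t"
      using e(2)[OF Y(1) _ p] by blast
    show "((\<lambda>t. fundamental_matrix \<phi> Y t p) \<longlongrightarrow> 0) at_top"
    proof (rule Lim_null_comparison)
      show "\<forall>\<^sub>F t in at_top. norm (fundamental_matrix \<phi> Y t p) \<le> c * (K * exp (ln \<gamma> * t))"
        using eventually_ge_at_top[of 0]
      proof eventually_elim
        case (elim t)
        then have "c * induced_norm N (fundamental_matrix \<phi> Y t p) \<le> c * (K * \<gamma> powr t)"
          using K(4) c(1) by (intro mult_left_mono) auto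
        then show ?case
          using c(2)[of "fundamental_matrix \<phi> Y t p"] K by (simp add: powr_def mult.commute)
      qed
      have "filterlim (\<lambda>t. ln \<gamma> * t) at_bot at_top"
        using K by (intro filterlim_tendsto_neg_mult_at_bot[of _ "ln \<gamma>"] tendsto_const filterlim_ident) auto
      then have "((\<lambda>t. exp (ln \<gamma> * t)) \<longlongrightarrow> 0) at_top"
        by (rule filterlim_compose[OF exp_at_bot])
      then show "((\<lambda>t. c * (K * exp (ln \<gamma> * t))) \<longlongrightarrow> 0) at_top"
        by (intro tendsto_mult_right_zero)
    qed
  qed
qed

end

subsection \<open>Perturbations along a periodic orbit\<close>

lemma linear_ode_lipschitz:
  fixes A M :: "real \<Rightarrow> real^'n^'n"
  assumes M: "\<And>t. 0 \<le> t \<Longrightarrow> t \<le> T \<Longrightarrow> (M has_vector_derivative A t ** M t) (at t within {0..T})"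
    and A: "\<And>t. 0 \<le> t \<Longrightarrow> t \<le> T \<Longrightarrow> norm (A t) \<le> c"
    and m: "\<And>t. 0 \<le> t \<Longrightarrow> t \<le> T \<Longrightarrow> norm (M t) \<le> m"
    and s: "0 \<le> s" "s \<le> T"
  shows "norm (M T - M s) \<le> c * m * (T - s)"
proof -
  have c: "0 \<le> c" using A[OF s] norm_ge_zero order_trans by blast
  have "norm (M T - M s) \<le> c * m * norm (T - s)"
  proof (rule differentiable_bound[of "{0..T}"])
    fix t assume t: "t \<in> {0..T}"
    show "(M has_derivative (\<lambda>h. h *\<^sub>R (A t ** M t))) (at t within {0..T})"
      using M[of t] t by (simp add: has_vector_derivative_def)
    have "norm (A t ** M t) \<le> c * m"
      using t A[of t] m[of t] c by (intro order_trans[OF norm_matrix_mult_le] mult_mono) auto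
    then show "onorm (\<lambda>h. h *\<^sub>R (A t ** M t)) \<le> c * m"
      by (intro onorm_le) (simp add: mult.commute mult_left_mono)
  qed (use s in auto)
  then show ?thesis using s by simp
qed

text \<open>A continuous map from a compact space to a Hausdorff space is a quotient map onto its
  image. It is applied to the parametrization of a periodic orbit, which glues the two ends of an
  interval.\<close>

lemma continuous_on_compact_image:
  fixes q :: "'a::topological_space \<Rightarrow> 'b::t2_space" and f :: "'b \<Rightarrow> 'c::topological_space"
  assumes S: "compact S" and q: "continuous_on S q" and fq: "continuous_on S (f \<circ> q)"
    and T: "closed S"
  shows "continuous_on (q ` S) f"
  unfolding continuous_on_closed_invariant
proof (intro allI impI)
  fix B :: "'c set" assume "closed B"
  then have "compact (S \<inter> (f \<circ> q) -` B)"
    using S T fq by (metis closed_vimage_Int compact_Int_closed inf.idem inf_assoc inf_commute)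
  then have "compact (q ` (S \<inter> (f \<circ> q) -` B))"
    using q by (intro compact_continuous_image) (auto elim: continuous_on_subset)
  then have "closed (q ` (S \<inter> (f \<circ> q) -` B))"
    by (rule compact_imp_closed)
  moreover have "q ` (S \<inter> (f \<circ> q) -` B) \<inter> q ` S = f -` B \<inter> q ` S" by auto
  ultimately show "\<exists>A. closed A \<and> A \<inter> q ` S = f -` B \<inter> q ` S" by blast
qed

text \<open>Tietze extension is applied to each entry, so it is the entry bounds that survive the
  extension.\<close>

lemma Tietze_matrix:
  fixes f :: "'w::metric_space \<Rightarrow> real^'n^'m"
  assumes "closedin (top_of_set W) S" and f: "continuous_on S f"
    and le: "\<And>x i j. x \<in> S \<Longrightarrow> \<bar>f x $ i $ j\<bar> \<le> r" and r: "0 \<le> r"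
  obtains g where "continuous_on W g" "\<And>x. x \<in> S \<Longrightarrow> g x = f x"
    "\<And>x i j. x \<in> W \<Longrightarrow> \<bar>g x $ i $ j\<bar> \<le> r"
proof -
  have SW: "S \<subseteq> W" using assms(1) closedin_imp_subset by auto
  have "\<exists>g. continuous_on W g \<and> (\<forall>x\<in>S. g x = f x $ i $ j) \<and> (\<forall>x\<in>W. \<bar>g x\<bar> \<le> r)" for i j
  proof -
    have "normal_space (top_of_set W)"
      by (intro metrizable_imp_normal_space metrizable_space_subtopology metrizable_space_euclidean)
    moreover have "continuous_map (subtopology (top_of_set W) S) euclideanreal (\<lambda>x. f x $ i $ j)"
      using f SW by (auto simp: subtopology_subtopology inf.absorb2 intro: continuous_intros)
    ultimately obtain g where g: "continuous_map (top_of_set W) euclideanreal g"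
      "g ` topspace (top_of_set W) \<subseteq> {-r..r}" "\<And>x. x \<in> S \<Longrightarrow> g x = f x $ i $ j"
      using Tietze_extension_realinterval[of "top_of_set W" S "{-r..r}" "\<lambda>x. f x $ i $ j"] assms(1) r le
      by (auto simp: is_interval_cc image_subset_iff abs_le_iff minus_le_iff)
    have "\<bar>g x\<bar> \<le> r" if "x \<in> W" for x
    proof -
      have "g x \<in> {-r..r}" using g(2) that by auto
      then show ?thesis by (simp add: abs_le_iff)
    qed
    then show ?thesis using g by auto
  qed
  then obtain g where g: "\<And>i j. continuous_on W (g i j)" "\<And>i j x. x \<in> S \<Longrightarrow> g i j x = f x $ i $ j"
    "\<And>i j x. x \<in> W \<Longrightarrow> \<bar>g i j x\<bar> \<le> r"
    by metis
  show thesis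
  proof (rule that[of "\<lambda>x. \<chi> i j. g i j x"])
    show "continuous_on W (\<lambda>x. \<chi> i j. g i j x)"
      by (intro continuous_on_vec_lambda g)
  qed (use g in \<open>auto simp: vec_eq_iff\<close>)
qed

lemma abs_trace_le_norm: "\<bar>trace (A::real^'n^'n)\<bar> \<le> CARD('n) * norm A"
proof -
  have "\<bar>trace A\<bar> \<le> (\<Sum>i\<in>UNIV. \<bar>A $ i $ i\<bar>)" unfolding trace_def by (rule sum_abs)
  also have "\<dots> \<le> (\<Sum>i\<in>(UNIV::'n set). norm A)" by (intro sum_mono abs_matrix_entry_le_norm)
  finally show ?thesis by simp
qed

locale robust_system = driven_system W \<phi> X
  for W :: "'w::metric_space set" and \<phi> :: "real \<Rightarrow> 'w \<Rightarrow> 'w" and X :: "'w \<Rightarrow> real^'d^'d" +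
  fixes \<epsilon> :: real
  assumes \<epsilon>_pos: "0 < \<epsilon>"
    and robust: "\<And>Y p. continuous_on W Y \<Longrightarrow> (\<And>w. w \<in> W \<Longrightarrow> norm (X w - Y w) \<le> \<epsilon>) \<Longrightarrow>
       periodic_point W \<phi> p \<Longrightarrow> ((\<lambda>t. fundamental_matrix \<phi> Y t p) \<longlongrightarrow> 0) at_top"
begin

text \<open>A matrix with all entries at most \<rho> in modulus has norm at most \<epsilon>; this
  pays for the entrywise extension.\<close>

definition \<rho> :: real where "\<rho> = \<epsilon> / (CARD('d) * CARD('d))"

lemma \<rho>_pos: "0 < \<rho>"
  using \<epsilon>_pos by (simp add: \<rho>_def)

text \<open>A fixed point has no minimal period in this sense, because every positive time is a
  return time.\<close>

definition minimal_period :: "'w \<Rightarrow> real \<Rightarrow> bool" where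
  "minimal_period p \<tau> \<longleftrightarrow> p \<in> W \<and> 0 < \<tau> \<and> \<phi> \<tau> p = p \<and> (\<forall>s. 0 < s \<and> s < \<tau> \<longrightarrow> \<phi> s p \<noteq> p)"

text \<open>A semiflow cannot be run backwards. Instead both points are flowed on by
  \<open>\<tau> - t\<close>, which completes the period and yields a return time
  \<open>\<tau> - t + s\<close>.\<close>

lemma orbit_inj:
  assumes p: "minimal_period p \<tau>" and st: "0 \<le> s" "s < t" "t \<le> \<tau>" "\<phi> s p = \<phi> t p"
  shows "s = 0 \<and> t = \<tau>"
proof -
  have "\<phi> (\<tau> - t + s) p = \<phi> (\<tau> - t) (\<phi> t p)"
    using flow_add[of "\<tau> - t" s p] p st by (simp add: minimal_period_def)
  also have "\<dots> = \<phi> \<tau> p"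
    using flow_add[of "\<tau> - t" t p] p st by (simp add: minimal_period_def)
  also have "\<dots> = p" using p by (simp add: minimal_period_def)
  finally have "\<phi> (\<tau> - t + s) p = p" .
  then have "\<not> (0 < \<tau> - t + s \<and> \<tau> - t + s < \<tau>)" using p unfolding minimal_period_def by blast
  then show ?thesis using st by auto
qed

text \<open>The deviation of B from X descends to the orbit, since only the end times meet, and is
  extended to \<open>W\<close>. Extending the deviation instead of B itself keeps Y close to X
  everywhere.\<close>

lemma extend_from_orbit:
  assumes p: "minimal_period p \<tau>" and B: "continuous_on {0..\<tau>} B" "B 0 = B \<tau>"
    and close: "\<And>t. 0 \<le> t \<Longrightarrow> t \<le> \<tau> \<Longrightarrow> norm (B t - X (\<phi> t p)) \<le> \<rho>"
  obtains Y where "continuous_on W Y" "\<And>w. w \<in> W \<Longrightarrow> norm (X w - Y w) \<le> \<epsilon>"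
    "\<And>t. 0 \<le> t \<Longrightarrow> t \<le> \<tau> \<Longrightarrow> Y (\<phi> t p) = B t"
proof -
  have pW: "p \<in> W" and \<tau>: "0 < \<tau>" and per: "\<phi> \<tau> p = p" using p by (auto simp: minimal_period_def)
  define D where "D t = B t - X (\<phi> t p)" for t
  have D_cont: "continuous_on {0..\<tau>} D"
    unfolding D_def using pW by (intro continuous_intros B continuous_X_orbit) auto
  have D_eq: "D s = D t" if "0 \<le> s" "s \<le> \<tau>" "0 \<le> t" "t \<le> \<tau>" "\<phi> s p = \<phi> t p" for s t
  proof -
    consider "s = t" | "s < t" | "t < s" by linarith
    then show ?thesis
      using orbit_inj[OF p, of s t] orbit_inj[OF p, of t s] that per pW B(2) by cases (auto simp: D_def)
  qed
  \<comment> \<open>\<open>D_eq\<close> makes the chosen time immaterial.\<close>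
  define f where "f x = D (SOME t. t \<in> {0..\<tau>} \<and> \<phi> t p = x)" for x
  have f: "f (\<phi> t p) = D t" if "t \<in> {0..\<tau>}" for t
  proof -
    have "(SOME s. s \<in> {0..\<tau>} \<and> \<phi> s p = \<phi> t p) \<in> {0..\<tau>} \<and> \<phi> (SOME s. s \<in> {0..\<tau>} \<and> \<phi> s p = \<phi> t p) p = \<phi> t p"
      by (rule someI[of "\<lambda>s. s \<in> {0..\<tau>} \<and> \<phi> s p = \<phi> t p" t]) (use that in simp)
    then show ?thesis unfolding f_def using that by (intro D_eq) auto
  qed
  let ?O = "(\<lambda>t. \<phi> t p) ` {0..\<tau>}"
  have orbit_cont: "continuous_on {0..\<tau>} (\<lambda>t. \<phi> t p)" using pW by (intro continuous_orbit) auto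
  have "continuous_on {0..\<tau>} (f \<circ> (\<lambda>t. \<phi> t p))"
    by (rule continuous_on_eq[OF D_cont]) (simp add: f)
  then have "continuous_on ?O f"
    using orbit_cont by (intro continuous_on_compact_image) auto
  moreover have "closedin (top_of_set W) ?O"
  proof (rule closed_subset)
    show "?O \<subseteq> W" using pW by auto
    show "closed ?O" using orbit_cont by (intro compact_imp_closed compact_continuous_image) auto
  qed
  moreover have "\<bar>f x $ i $ j\<bar> \<le> \<rho>" if x: "x \<in> ?O" for x i j
  proof -
    obtain t where t: "t \<in> {0..\<tau>}" "x = \<phi> t p" using x by blast
    have "\<bar>f x $ i $ j\<bar> \<le> norm (f x)" by (rule abs_matrix_entry_le_norm)
    also have "\<dots> \<le> \<rho>" using close[of t] t f[of t] by (simp add: D_def)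
    finally show ?thesis .
  qed
  ultimately obtain g where g: "continuous_on W g" "\<And>x. x \<in> ?O \<Longrightarrow> g x = f x"
    "\<And>x i j. x \<in> W \<Longrightarrow> \<bar>g x $ i $ j\<bar> \<le> \<rho>"
    using Tietze_matrix[of W ?O f \<rho>] \<rho>_pos by (metis less_imp_le)
  show thesis
  proof (rule that[of "\<lambda>w. X w + g w"])
    show "continuous_on W (\<lambda>w. X w + g w)" by (intro continuous_intros continuous_X g)
    show "X (\<phi> t p) + g (\<phi> t p) = B t" if "0 \<le> t" "t \<le> \<tau>" for t
      using that g(2)[of "\<phi> t p"] f[of t] by (simp add: D_def)
    show "norm (X w - (X w + g w)) \<le> \<epsilon>" if "w \<in> W" for w
    proof -
      have "norm (g w) \<le> (\<Sum>i\<in>UNIV. \<Sum>j\<in>UNIV. \<bar>g w $ i $ j\<bar>)" by (rule norm_matrix_le_sum_entries)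
      also have "\<dots> \<le> (\<Sum>i\<in>(UNIV::'d set). \<Sum>j\<in>(UNIV::'d set). \<rho>)"
        by (intro sum_mono g that)
      also have "\<dots> = \<epsilon>" by (simp add: \<rho>_def)
      finally show ?thesis by simp
    qed
  qed
qed

text \<open>By periodicity and the cocycle law the powers of the period matrix are the solution at
  multiples of \<tau>, which tends to 0 by robustness.\<close>

lemma trace_period_le:
  assumes p: "p \<in> W" "0 < \<tau>" "\<phi> \<tau> p = p"
    and Y: "continuous_on W Y" "\<And>w. w \<in> W \<Longrightarrow> norm (X w - Y w) \<le> \<epsilon>"
  shows "\<bar>trace (fundamental_matrix \<phi> Y \<tau> p)\<bar> \<le> CARD('d)"
proof -
  interpret Y: driven_system W \<phi> Y
    using compact_W semiflow Y by unfold_locales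
  have per: "\<phi> (real k * \<tau>) p = p" for k
  proof (induction k)
    case (Suc k)
    then show ?case using flow_add[of \<tau> "real k * \<tau>" p] p by (simp add: algebra_simps)
  qed (use p in simp)
  have "(((**) (Y.F \<tau> p)) ^^ k) (mat 1) = Y.F (real k * \<tau>) p" for k
  proof (induction k)
    case (Suc k)
    then show ?case
      using Y.F_cocycle[of p \<tau> "real k * \<tau>"] p per[of k] by (simp add: algebra_simps)
  qed (use p in simp)
  moreover have "(\<lambda>k. Y.F (real k * \<tau>) p) \<longlonglongrightarrow> 0"
  proof (rule filterlim_compose[OF robust[OF Y]])
    show "periodic_point W \<phi> p" using p by (auto simp: periodic_point_def intro!: exI[of _ \<tau>])
    show "filterlim (\<lambda>k. real k * \<tau>) at_top sequentially"
      using p by (intro filterlim_at_top_mult_tendsto_pos[of _ \<tau>] tendsto_const filterlim_real_sequentially) auto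
  qed
  ultimately show ?thesis by (intro abs_trace_le_card) simp
qed

text \<open>The perturbation \<open>B\<close> need not close up: it is modified near the end of the period, on a time
  interval so short that the solution hardly changes.\<close>
lemma trace_along_orbit_le:
  assumes p: "minimal_period p \<tau>" and B: "continuous_on {0..\<tau>} B"
    and close: "\<And>t. 0 \<le> t \<Longrightarrow> t \<le> \<tau> \<Longrightarrow> norm (B t - X (\<phi> t p)) \<le> \<rho>"
    and M: "\<And>t. 0 \<le> t \<Longrightarrow> t \<le> \<tau> \<Longrightarrow> (M has_vector_derivative B t ** M t) (at t within {0..\<tau>})"
    and M0: "M 0 = mat 1"
  shows "\<bar>trace (M \<tau>)\<bar> \<le> CARD('d)"
proof -
  have pW: "p \<in> W" and \<tau>: "0 < \<tau>" and per: "\<phi> \<tau> p = p" using p by (auto simp: minimal_period_def)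
  obtain c where c: "0 < c" "\<And>w. w \<in> W \<Longrightarrow> norm (X w) \<le> c" using bound_X by blast
  define c' where "c' = c + \<epsilon> + \<rho>"
  have c': "0 \<le> c'" "c + \<epsilon> \<le> c'" "c + \<rho> \<le> c'" using c \<epsilon>_pos \<rho>_pos by (auto simp: c'_def)
  define m where "m = CARD('d) * ode_growth c' \<tau>"
  have m: "0 \<le> m" by (simp add: m_def ode_growth_def)
  have Bc: "norm (B t) \<le> c'" if "0 \<le> t" "t \<le> \<tau>" for t
    using close[OF that] c(2)[of "\<phi> t p"] pW that c'(3) norm_triangle_sub[of "B t" "X (\<phi> t p)"] by simp
  have growth: "norm (P t) \<le> m"
    if "\<And>t. 0 \<le> t \<Longrightarrow> t \<le> \<tau> \<Longrightarrow> (P has_vector_derivative A t ** P t) (at t within {0..\<tau>})"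
      "\<And>t. 0 \<le> t \<Longrightarrow> t \<le> \<tau> \<Longrightarrow> norm (A t) \<le> c'" "P 0 = mat 1" "0 \<le> t" "t \<le> \<tau>"
    for P A :: "real \<Rightarrow> real^'d^'d" and t :: real
  proof -
    have "norm (P t) \<le> norm (P 0) * ode_growth c' t"
      using that by (intro linear_ode_growth[where A = A])
        (auto intro: has_vector_derivative_within_subset[OF that(1)])
    also have "\<dots> \<le> CARD('d) * ode_growth c' \<tau>"
      using that norm_mat_1_le[where 'n='d] c'
      by (intro mult_mono ode_growth_mono) (auto simp: ode_growth_def)
    finally show ?thesis by (simp add: m_def)
  qed
  have approx: "\<bar>trace (M \<tau>)\<bar> \<le> CARD('d) + CARD('d) * (2 * (c' * m * k))" if k: "0 < k" "k < \<tau>" for k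
  proof -
    \<comment> \<open>A ramp that vanishes up to \<open>\<tau> - k\<close> and reaches 1 at
      \<tau>.\<close>
    define \<theta> where "\<theta> t = max 0 ((t - (\<tau> - k)) / k)" for t
    have \<theta>: "0 \<le> \<theta> t" "t \<le> \<tau> \<Longrightarrow> \<theta> t \<le> 1" for t using k by (auto simp: \<theta>_def field_simps)
    have \<theta>0: "\<theta> t = 0" if "t \<le> \<tau> - k" for t
      using that k by (auto simp: \<theta>_def max_def field_simps)
    \<comment> \<open>The target of the blend is X along the orbit plus the deviation at time 0. At
      \<tau> it equals \<open>B 0\<close>, and a convex combination of deviations of size \<rho>
      stays within \<rho>.\<close>
    define B' where "B' t = (1 - \<theta> t) *\<^sub>R B t + \<theta> t *\<^sub>R (X (\<phi> t p) + (B 0 - X (\<phi> 0 p)))" for t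
    have "continuous_on {0..\<tau>} \<theta>"
      unfolding \<theta>_def using k by (intro continuous_intros) auto
    then have "continuous_on {0..\<tau>} B'"
      unfolding B'_def using pW by (intro continuous_intros B continuous_X_orbit) auto
    moreover have "B' 0 = B' \<tau>"
      using k \<theta>0[of 0] per pW by (simp add: B'_def) (simp add: \<theta>_def)
    moreover have "norm (B' t - X (\<phi> t p)) \<le> \<rho>" if t: "0 \<le> t" "t \<le> \<tau>" for t
    proof -
      have "B' t - X (\<phi> t p) = (1 - \<theta> t) *\<^sub>R (B t - X (\<phi> t p)) + \<theta> t *\<^sub>R (B 0 - X (\<phi> 0 p))"
        by (simp add: B'_def algebra_simps)
      also have "norm \<dots> \<le> (1 - \<theta> t) * norm (B t - X (\<phi> t p)) + \<theta> t * norm (B 0 - X (\<phi> 0 p))"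
        using \<theta>[of t] t by (intro order_trans[OF norm_triangle_ineq]) simp
      also have "\<dots> \<le> (1 - \<theta> t) * \<rho> + \<theta> t * \<rho>"
        using \<theta>[of t] t \<tau> by (intro add_mono mult_left_mono close) auto
      finally show ?thesis by (simp add: algebra_simps)
    qed
    ultimately obtain Y where Y: "continuous_on W Y" "\<And>w. w \<in> W \<Longrightarrow> norm (X w - Y w) \<le> \<epsilon>"
      "\<And>t. 0 \<le> t \<Longrightarrow> t \<le> \<tau> \<Longrightarrow> Y (\<phi> t p) = B' t"
      using extend_from_orbit[OF p, of B'] by blast
    interpret Y: driven_system W \<phi> Y
      using compact_W semiflow Y by unfold_locales
    have Yc: "norm (Y w) \<le> c'" if "w \<in> W" for w
      using Y(2)[OF that] c(2)[OF that] c'(2) norm_triangle_sub[of "Y w" "X w"]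
      by (simp add: norm_minus_commute)
    have dY: "((\<lambda>t. Y.F t p) has_vector_derivative Y (\<phi> t p) ** Y.F t p) (at t within {0..\<tau>})"
      if "0 \<le> t" "t \<le> \<tau>" for t using that pW by (intro Y.F_deriv) auto
    have "M (\<tau> - k) = Y.F (\<tau> - k) p ** M 0"
    proof (rule Y.F_unique)
      fix t assume t: "0 \<le> t" "t \<le> \<tau> - k"
      then have "Y (\<phi> t p) = B t" using Y(3)[of t] \<theta>0[of t] k by (simp add: B'_def)
      then show "(M has_vector_derivative Y (\<phi> t p) ** M t) (at t within {0..\<tau> - k})"
        using M[of t] t k by (auto intro: has_vector_derivative_within_subset)
    qed (use pW k in auto)
    then have eq: "M (\<tau> - k) = Y.F (\<tau> - k) p" by (simp add: M0)
    have "norm (M \<tau> - M (\<tau> - k)) \<le> c' * m * (\<tau> - (\<tau> - k))"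
      using k by (intro linear_ode_lipschitz[where A = B] M Bc growth[OF M Bc M0]) auto
    moreover have "norm (Y.F \<tau> p - Y.F (\<tau> - k) p) \<le> c' * m * (\<tau> - (\<tau> - k))"
      using k pW
      by (intro linear_ode_lipschitz[where A = "\<lambda>t. Y (\<phi> t p)" and M = "\<lambda>t. Y.F t p"] dY
          growth[where A = "\<lambda>t. Y (\<phi> t p)" and P = "\<lambda>t. Y.F t p"] Yc) auto
    ultimately have "norm (M \<tau> - Y.F \<tau> p) \<le> 2 * (c' * m * k)"
      using norm_triangle_ineq4[of "M \<tau> - M (\<tau> - k)" "Y.F \<tau> p - Y.F (\<tau> - k) p"] by (simp add: eq)
    then have "\<bar>trace (M \<tau> - Y.F \<tau> p)\<bar> \<le> CARD('d) * (2 * (c' * m * k))"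
      by (intro order_trans[OF abs_trace_le_norm] mult_left_mono) auto
    moreover have "\<bar>trace (Y.F \<tau> p)\<bar> \<le> CARD('d)"
      by (rule trace_period_le[OF pW \<tau> per Y(1,2)])
    ultimately show ?thesis by (simp add: trace_sub)
  qed
  \<comment> \<open>The length k of the modified interval tends to 0, while \<open>c'\<close> and m
    do not depend on k.\<close>
  show ?thesis
  proof (rule tendsto_lowerbound)
    have "((\<lambda>k. CARD('d) + CARD('d) * (2 * (c' * m * k))) \<longlongrightarrow> CARD('d) + CARD('d) * (2 * (c' * m * 0))) (at_right 0)"
      by (intro tendsto_intros)
    then show "((\<lambda>k. CARD('d) + CARD('d) * (2 * (c' * m * k))) \<longlongrightarrow> CARD('d)) (at_right 0)" by simp
    show "\<forall>\<^sub>F k in at_right 0. \<bar>trace (M \<tau>)\<bar> \<le> CARD('d) + CARD('d) * (2 * (c' * m * k))"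
      by (rule eventually_at_rightI[OF _ \<tau>]) (use approx in auto)
  qed simp
qed

end

subsection \<open>Uniform decay along periodic orbits\<close>

lemma norm_scaleR_mono:
  fixes Z :: "'a::real_normed_vector"
  assumes "0 \<le> s" "s \<le> b" "norm Z \<le> n"
  shows "norm (s *\<^sub>R Z) \<le> b * n"
proof -
  have "s * norm Z \<le> b * n" using assms by (intro mult_mono) auto
  then show ?thesis using assms by simp
qed

text \<open>The square of R is R or 0, which makes the inverse of I + h R explicit; the trace of R A
  isolates one entry of A.\<close>

lemma matrix_unit_facts:
  fixes i j :: "'n::finite"
  defines "R \<equiv> (\<chi> k l. if k = i \<and> l = j then 1 else 0) :: real^'n^'n"
  shows "R ** R = (if i = j then 1 else 0) *\<^sub>R R" "norm R \<le> 1" "trace (R ** A) = A $ j $ i"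
proof -
  have mult: "(R ** A) $ k $ l = (if k = i then A $ j $ l else 0)" for A :: "real^'n^'n" and k l
  proof -
    have "(R ** A) $ k $ l = (\<Sum>h\<in>UNIV. R $ k $ h * A $ h $ l)"
      by (simp add: matrix_matrix_mult_def)
    also have "\<dots> = (\<Sum>h\<in>UNIV. if h = j then (if k = i then A $ h $ l else 0) else 0)"
      by (rule sum.cong) (auto simp: R_def)
    finally show ?thesis by simp
  qed
  show "R ** R = (if i = j then 1 else 0) *\<^sub>R R"
    by (auto simp: vec_eq_iff mult) (auto simp: R_def)
  show "trace (R ** A) = A $ j $ i"
    by (simp add: trace_def mult)
  have "norm R \<le> (\<Sum>k\<in>UNIV. \<Sum>l\<in>UNIV. \<bar>R $ k $ l\<bar>)" by (rule norm_matrix_le_sum_entries)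
  also have "\<dots> = (\<Sum>k\<in>(UNIV::'n set). \<Sum>l\<in>(UNIV::'n set). if l = j then (if k = i then 1 else 0) else 0)"
    by (intro sum.cong refl) (simp add: R_def)
  also have "\<dots> = 1" by simp
  finally show "norm R \<le> 1" .
qed

context robust_system
begin

text \<open>The solution is multiplied by \<open>exp (\<kappa> t)\<close> and by \<open>I + (t \<delta> / \<tau>) R\<close>, with \<open>R\<close> a matrix unit;
  the product solves a nearby equation, whose coefficient matrix is \<open>B\<close>.\<close>
lemma perturbed_trace_le:
  fixes A M :: "real \<Rightarrow> real^'d^'d" and c \<kappa> \<delta> :: real
  assumes p: "minimal_period p \<tau>" and \<tau>: "1 \<le> \<tau>"
    and A: "continuous_on {0..\<tau>} A" "\<And>t. 0 \<le> t \<Longrightarrow> t \<le> \<tau> \<Longrightarrow> norm (A t) \<le> c"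
      "\<And>t. 0 \<le> t \<Longrightarrow> t \<le> \<tau> \<Longrightarrow> norm (A t - X (\<phi> t p)) \<le> \<rho> / 4"
    and M: "\<And>t. 0 \<le> t \<Longrightarrow> t \<le> \<tau> \<Longrightarrow> (M has_vector_derivative A t ** M t) (at t within {0..\<tau>})"
    and M0: "M 0 = mat 1"
    and \<kappa>: "0 \<le> \<kappa>" "\<kappa> * CARD('d) \<le> \<rho> / 4"
    and \<delta>: "0 \<le> \<delta>" "\<delta> \<le> 1" "\<delta> * (real CARD('d) + 1 + c * (real CARD('d) + 2)) \<le> \<rho> / 2"
  shows "exp (\<kappa> * \<tau>) * \<bar>trace (M \<tau>) + \<delta> * M \<tau> $ j $ i\<bar> \<le> CARD('d)"
proof -
  define R :: "real^'d^'d" where "R = (\<chi> k l. if k = i \<and> l = j then 1 else 0)"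
  define r :: real where "r = (if i = j then 1 else 0)"
  have R: "R ** R = r *\<^sub>R R" "norm R \<le> 1" "trace (R ** P) = P $ j $ i" for P
    unfolding R_def r_def by (rule matrix_unit_facts)+
  have r: "0 \<le> r" by (simp add: r_def)
  have c: "0 \<le> c" using A(2)[of 0] \<tau> norm_ge_zero order_trans by (metis order_refl zero_le_one)
  define h where "h t = \<delta> * t / \<tau>" for t
  \<comment> \<open>Chosen so that I - a R inverts I + h R, using that R squared is r R.\<close>
  define a where "a t = h t / (1 + h t * r)" for t
  have h: "0 \<le> h t" "h t \<le> \<delta>" if "0 \<le> t" "t \<le> \<tau>" for t
    using that \<tau> \<delta> by (auto simp: h_def divide_le_eq mult_left_mono)
  have hr: "0 < 1 + h t * r" if "0 \<le> t" "t \<le> \<tau>" for t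
    using h[OF that] r by (simp add: add_pos_nonneg)
  have a: "0 \<le> a t" "a t \<le> \<delta>" if "0 \<le> t" "t \<le> \<tau>" for t
  proof -
    show "0 \<le> a t" using h[OF that] hr[OF that] by (simp add: a_def)
    have "h t * 1 \<le> h t * (1 + h t * r)" using h[OF that] r by (intro mult_left_mono) auto
    then have "a t \<le> h t" using hr[OF that] by (simp add: a_def divide_le_eq)
    then show "a t \<le> \<delta>" using h(2)[OF that] by simp
  qed
  define G where "G t = mat 1 + h t *\<^sub>R R" for t
  define H where "H t = mat 1 - a t *\<^sub>R R" for t
  have HG: "H t ** G t = mat 1" if "0 \<le> t" "t \<le> \<tau>" for t
  proof -
    have "H t ** G t = mat 1 + (h t - a t * (1 + h t * r)) *\<^sub>R R"
      by (simp add: H_def G_def matrix_mult.add_right matrix_mult.diff_left matrix_mult.scaleR_left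
          matrix_mult.scaleR_right R algebra_simps)
    also have "h t - a t * (1 + h t * r) = 0" using hr[OF that] by (simp add: a_def)
    finally show ?thesis by simp
  qed
  have HGM: "H t ** (G t ** P) = P" if "0 \<le> t" "t \<le> \<tau>" for t P
    using HG[OF that] by (simp add: matrix_mul_assoc)
  \<comment> \<open>B is P' times the inverse of P, for the product P defined next: one term each
    from the exponential, from the derivative of G, and from A conjugated by G.\<close>
  define B where "B t = \<kappa> *\<^sub>R mat 1 + (\<delta> / \<tau>) *\<^sub>R (R ** H t) + G t ** (A t ** H t)" for t
  define P where "P t = exp (\<kappa> * t) *\<^sub>R (G t ** M t)" for t
  have "\<bar>trace (P \<tau>)\<bar> \<le> CARD('d)"
  proof (rule trace_along_orbit_le[OF p])
    have "continuous_on {0..\<tau>} h" unfolding h_def using \<tau> by (intro continuous_intros) auto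
    moreover have "continuous_on {0..\<tau>} a"
      unfolding a_def using calculation hr by (intro continuous_intros) (auto simp: less_imp_neq[THEN not_sym])
    ultimately show "continuous_on {0..\<tau>} B"
      unfolding B_def G_def H_def by (intro continuous_intros matrix_mult.continuous_on A)
    show "P 0 = mat 1" by (simp add: P_def G_def h_def M0)
    fix t assume t: "0 \<le> t" "t \<le> \<tau>"
    have nH: "norm (H t) \<le> real CARD('d) + 1"
    proof -
      have "norm (H t) \<le> norm (mat 1 :: real^'d^'d) + norm (a t *\<^sub>R R)"
        unfolding H_def by (rule norm_triangle_ineq4)
      also have "norm (a t *\<^sub>R R) \<le> 1"
        using a[OF t] \<delta>(2) R(2) by (simp add: mult_le_one)
      finally show ?thesis using norm_mat_1_le[where 'n='d] by simp
    qed
    have bound1: "norm (\<kappa> *\<^sub>R (mat 1 :: real^'d^'d)) \<le> \<rho> / 4"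
      using mult_left_mono[OF norm_mat_1_le[where 'n='d] \<kappa>(1)] \<kappa> by simp
    have bound2: "norm ((\<delta> / \<tau>) *\<^sub>R (R ** H t)) \<le> \<delta> * (1 * (real CARD('d) + 1))"
    proof -
      have "\<delta> / \<tau> \<le> \<delta>" using \<tau> mult_left_mono[OF \<tau> \<delta>(1)] by (simp add: divide_le_eq)
      moreover have "norm (R ** H t) \<le> 1 * (real CARD('d) + 1)"
        by (intro norm_matrix_mult_mono R nH)
      ultimately show ?thesis using \<delta> \<tau> by (intro norm_scaleR_mono) auto
    qed
    have bound3: "norm (h t *\<^sub>R (R ** (A t ** H t))) \<le> \<delta> * (1 * (c * (real CARD('d) + 1)))"
    proof -
      have "norm (A t ** H t) \<le> c * (real CARD('d) + 1)"
        by (intro norm_matrix_mult_mono A(2)[OF t] nH)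
      then have "norm (R ** (A t ** H t)) \<le> 1 * (c * (real CARD('d) + 1))"
        by (rule norm_matrix_mult_mono[OF R(2)])
      then show ?thesis using h[OF t] by (intro norm_scaleR_mono)
    qed
    have bound4: "norm (a t *\<^sub>R (A t ** R)) \<le> \<delta> * (c * 1)"
    proof -
      have "norm (A t ** R) \<le> c * 1"
        by (intro norm_matrix_mult_mono A(2)[OF t] R(2))
      then show ?thesis using a[OF t] by (intro norm_scaleR_mono)
    qed
    have "G t ** (A t ** H t) = A t - a t *\<^sub>R (A t ** R) + h t *\<^sub>R (R ** (A t ** H t))"
      by (simp add: G_def matrix_mult.add_left matrix_mult.scaleR_left)
        (simp add: H_def matrix_mult.diff_right matrix_mult.scaleR_right)
    then have "B t - X (\<phi> t p) = \<kappa> *\<^sub>R mat 1 + (\<delta> / \<tau>) *\<^sub>R (R ** H t) + h t *\<^sub>R (R ** (A t ** H t))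
        + (A t - X (\<phi> t p)) - a t *\<^sub>R (A t ** R)"
      by (simp add: B_def)
    also have "norm \<dots> \<le> norm (\<kappa> *\<^sub>R (mat 1 :: real^'d^'d)) + norm ((\<delta> / \<tau>) *\<^sub>R (R ** H t))
        + norm (h t *\<^sub>R (R ** (A t ** H t))) + norm (A t - X (\<phi> t p)) + norm (a t *\<^sub>R (A t ** R))"
      by (intro order_trans[OF norm_triangle_ineq4] order_trans[OF norm_triangle_ineq] add_mono order_refl)
    \<comment> \<open>The three terms with \<delta> add up to the quantity that the hypothesis on
      \<delta> bounds by \<open>\<rho> / 2\<close>. The bound on the second summand uses
      \<open>1 \<le> \<tau>\<close>.\<close>
    also have "\<dots> \<le> \<rho> / 4 + \<delta> * (1 * (real CARD('d) + 1)) + \<delta> * (1 * (c * (real CARD('d) + 1))) + \<rho> / 4 + \<delta> * (c * 1)"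
      by (intro add_mono bound1 bound2 bound3 bound4 A(3)[OF t])
    also have "\<dots> = \<rho> / 2 + \<delta> * (real CARD('d) + 1 + c * (real CARD('d) + 2))" by (simp add: algebra_simps)
    also have "\<dots> \<le> \<rho>" using \<delta>(3) by simp
    finally show "norm (B t - X (\<phi> t p)) \<le> \<rho>" .
    have "(G has_vector_derivative (\<delta> / \<tau>) *\<^sub>R R) (at t within {0..\<tau>})"
      unfolding G_def h_def using \<tau>
      by (auto intro!: derivative_eq_intros has_vector_derivative_real_field simp: has_vector_derivative_def)
    from matrix_mult.has_vector_derivative[OF this M[OF t]]
    have GM: "((\<lambda>t. G t ** M t) has_vector_derivative G t ** (A t ** M t) + (\<delta> / \<tau>) *\<^sub>R (R ** M t)) (at t within {0..\<tau>})"
      by (simp add: matrix_mult.scaleR_left)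
    have "((\<lambda>t. exp (\<kappa> * t)) has_vector_derivative \<kappa> * exp (\<kappa> * t)) (at t within {0..\<tau>})"
      unfolding has_real_derivative_iff_has_vector_derivative[symmetric]
      by (auto intro!: derivative_eq_intros)
    from has_vector_derivative_scaleR[OF this[folded has_real_derivative_iff_has_vector_derivative] GM]
    show "(P has_vector_derivative B t ** P t) (at t within {0..\<tau>})"
      unfolding P_def
    proof (rule has_vector_derivative_eq_rhs)
      have "B t ** (G t ** M t) = \<kappa> *\<^sub>R (G t ** M t) + ((\<delta> / \<tau>) *\<^sub>R (R ** M t) + G t ** (A t ** M t))"
        by (simp add: B_def matrix_mult.add_left matrix_mult.scaleR_left matrix_mul_assoc[symmetric] HGM[OF t])
      then show "exp (\<kappa> * t) *\<^sub>R (G t ** (A t ** M t) + (\<delta> / \<tau>) *\<^sub>R (R ** M t)) +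
          (\<kappa> * exp (\<kappa> * t)) *\<^sub>R (G t ** M t) = B t ** (exp (\<kappa> * t) *\<^sub>R (G t ** M t))"
        by (simp add: matrix_mult.scaleR_right algebra_simps)
    qed
  qed
  moreover have "trace (P \<tau>) = exp (\<kappa> * \<tau>) * (trace (M \<tau>) + \<delta> * M \<tau> $ j $ i)"
  proof -
    have "h \<tau> = \<delta>" using \<tau> by (simp add: h_def)
    have scale: "trace (s *\<^sub>R Z) = s * trace Z" for s and Z :: "real^'d^'d"
      by (simp add: trace_def sum_distrib_left)
    show ?thesis
      by (simp add: P_def G_def \<open>h \<tau> = \<delta>\<close> matrix_mult.add_left matrix_mult.scaleR_left trace_add scale R(3))
  qed
  ultimately show ?thesis by (simp add: abs_mult)
qed

text \<open>The constants depend only on c, \<rho> and the dimension. That A need not be X along the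
  orbit of p lets a nearby orbit be substituted.\<close>

lemma period_matrix_decay:
  assumes c: "0 \<le> c"
  obtains C \<kappa> where "0 < C" "0 < \<kappa>"
    "\<And>p \<tau> A M. minimal_period p \<tau> \<Longrightarrow> 1 \<le> \<tau> \<Longrightarrow> continuous_on {0..\<tau>} A \<Longrightarrow>
      (\<And>t. 0 \<le> t \<Longrightarrow> t \<le> \<tau> \<Longrightarrow> norm (A t) \<le> c) \<Longrightarrow>
      (\<And>t. 0 \<le> t \<Longrightarrow> t \<le> \<tau> \<Longrightarrow> norm (A t - X (\<phi> t p)) \<le> \<rho> / 4) \<Longrightarrow>
      (\<And>t. 0 \<le> t \<Longrightarrow> t \<le> \<tau> \<Longrightarrow> (M has_vector_derivative A t ** M t) (at t within {0..\<tau>})) \<Longrightarrow>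
      M 0 = mat 1 \<Longrightarrow> norm (M \<tau>) \<le> C * exp (- (\<kappa> * \<tau>))"
proof -
  define d where "d = real CARD('d)"
  have d: "0 < d" by (simp add: d_def)
  define \<kappa> where "\<kappa> = \<rho> / 4 / d"
  define K where "K = d + 1 + c * (d + 2)"
  have K: "0 < K" using c d by (simp add: K_def add_pos_nonneg)
  define \<delta> where "\<delta> = min 1 (\<rho> / 2 / K)"
  have \<kappa>: "0 < \<kappa>" "\<kappa> * d \<le> \<rho> / 4" using \<rho>_pos d by (auto simp: \<kappa>_def)
  have \<delta>: "0 < \<delta>" "\<delta> \<le> 1" "\<delta> * K \<le> \<rho> / 2"
  proof -
    show "0 < \<delta>" "\<delta> \<le> 1" using \<rho>_pos K by (auto simp: \<delta>_def)
    have "\<delta> * K \<le> (\<rho> / 2 / K) * K" using K by (intro mult_right_mono) (auto simp: \<delta>_def)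
    then show "\<delta> * K \<le> \<rho> / 2" using K by simp
  qed
  show thesis
  proof (rule that[of "d * d * (2 * d / \<delta>)" \<kappa>])
    show "0 < d * d * (2 * d / \<delta>)" "0 < \<kappa>" using d \<delta> \<kappa> by auto
    fix p \<tau> and A M :: "real \<Rightarrow> real^'d^'d"
    assume *: "minimal_period p \<tau>" "1 \<le> \<tau>" "continuous_on {0..\<tau>} A"
      "\<And>t. 0 \<le> t \<Longrightarrow> t \<le> \<tau> \<Longrightarrow> norm (A t) \<le> c"
      "\<And>t. 0 \<le> t \<Longrightarrow> t \<le> \<tau> \<Longrightarrow> norm (A t - X (\<phi> t p)) \<le> \<rho> / 4"
      "\<And>t. 0 \<le> t \<Longrightarrow> t \<le> \<tau> \<Longrightarrow> (M has_vector_derivative A t ** M t) (at t within {0..\<tau>})"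
      "M 0 = mat 1"
    have tr: "exp (\<kappa> * \<tau>) * \<bar>trace (M \<tau>) + \<delta>' * M \<tau> $ j $ i\<bar> \<le> d"
      if "0 \<le> \<delta>'" "\<delta>' \<le> 1" "\<delta>' * K \<le> \<rho> / 2" for \<delta>' i j
      unfolding d_def
      by (rule perturbed_trace_le[OF *]) (use that \<kappa> in \<open>auto simp: d_def K_def\<close>)
    have entry: "\<bar>M \<tau> $ j $ i\<bar> \<le> 2 * d / \<delta> * exp (- (\<kappa> * \<tau>))" for i j
    proof -
      have "exp (\<kappa> * \<tau>) * (\<delta> * \<bar>M \<tau> $ j $ i\<bar>) = exp (\<kappa> * \<tau>) * \<bar>(trace (M \<tau>) + \<delta> * M \<tau> $ j $ i) - (trace (M \<tau>) + 0 * M \<tau> $ j $ i)\<bar>"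
        using \<delta> by (simp add: abs_mult)
      also have "\<dots> \<le> exp (\<kappa> * \<tau>) * \<bar>trace (M \<tau>) + \<delta> * M \<tau> $ j $ i\<bar> + exp (\<kappa> * \<tau>) * \<bar>trace (M \<tau>) + 0 * M \<tau> $ j $ i\<bar>"
        unfolding distrib_left[symmetric] by (intro mult_left_mono abs_triangle_ineq4) auto
      also have "\<dots> \<le> d + d"
        using \<delta> \<rho>_pos by (intro add_mono tr) auto
      finally show ?thesis using \<delta> by (simp add: exp_minus field_simps)
    qed
    have "norm (M \<tau>) \<le> (\<Sum>j\<in>UNIV. \<Sum>i\<in>UNIV. \<bar>M \<tau> $ j $ i\<bar>)" by (rule norm_matrix_le_sum_entries)
    also have "\<dots> \<le> (\<Sum>j\<in>(UNIV::'d set). \<Sum>i\<in>(UNIV::'d set). 2 * d / \<delta> * exp (- (\<kappa> * \<tau>)))"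
      by (intro sum_mono entry)
    also have "\<dots> = d * d * (2 * d / \<delta>) * exp (- (\<kappa> * \<tau>))" by (simp add: d_def)
    finally show "norm (M \<tau>) \<le> d * d * (2 * d / \<delta>) * exp (- (\<kappa> * \<tau>))" .
  qed
qed

section \<open>Periodic points of bounded period\<close>

text \<open>For positive L, every period up to 2 L has a multiple in this interval, so fixed points
  and all short periods are covered. Keeping s away from 0 is essential: time 0 would admit every
  point, and the set must be closed.\<close>

definition short_periodic :: "real \<Rightarrow> 'w set" where
  "short_periodic L = {p \<in> W. \<exists>s\<in>{L..2 * L}. \<phi> s p = p}"

lemma compact_short_periodic:
  assumes L: "0 \<le> L"
  shows "compact (short_periodic L)"
proof -
  let ?S = "{L..2 * L} \<times> W"
  have cont: "continuous_on ?S (\<lambda>x. \<phi> (fst x) (snd x))"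
    using L by (intro continuous_on_subset[OF continuous_flow[unfolded case_prod_beta]]) auto
  then have "continuous_on ?S (\<lambda>x. dist (\<phi> (fst x) (snd x)) (snd x))"
    by (intro continuous_intros)
  then have "closedin (top_of_set ?S) {x \<in> ?S. dist (\<phi> (fst x) (snd x)) (snd x) = 0}"
    by (rule continuous_closedin_preimage_constant)
  then have "compact {x \<in> ?S. dist (\<phi> (fst x) (snd x)) (snd x) = 0}"
    by (rule closedin_compact[OF compact_Times[OF compact_Icc compact_W]])
  then have "compact (snd ` {x \<in> ?S. dist (\<phi> (fst x) (snd x)) (snd x) = 0})"
    by (intro compact_continuous_image continuous_intros)
  also have "snd ` {x \<in> ?S. dist (\<phi> (fst x) (snd x)) (snd x) = 0} = short_periodic L"
    by (force simp: short_periodic_def image_iff)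
  finally show ?thesis .
qed

lemma short_periodic_flow:
  assumes "p \<in> short_periodic L" "0 \<le> t" "0 \<le> L"
  shows "\<phi> t p \<in> short_periodic L"
proof -
  obtain s where s: "s \<in> {L..2 * L}" "\<phi> s p = p" "p \<in> W" using assms by (auto simp: short_periodic_def)
  have "\<phi> s (\<phi> t p) = \<phi> t (\<phi> s p)"
    using flow_add[of s t p] flow_add[of t s p] s assms by (simp add: add.commute)
  then show ?thesis using s assms by (auto simp: short_periodic_def intro!: bexI[of _ s])
qed

lemma flow_multiple_period:
  assumes "p \<in> W" "0 \<le> s" "\<phi> s p = p"
  shows "\<phi> (real k * s) p = p"
proof (induction k)
  case (Suc k)
  then show ?case using flow_add[of s "real k * s" p] assms by (simp add: algebra_simps)
qed (use assms in simp)

lemma short_periodicI: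
  assumes p: "p \<in> W" "0 < s" "s \<le> 2 * L" "\<phi> s p = p" and L: "0 < L"
  shows "p \<in> short_periodic L"
proof (cases "L \<le> s")
  case True
  then show ?thesis using p by (auto simp: short_periodic_def)
next
  case False
  \<comment> \<open>The first multiple of s that is at least L overshoots by less than s, hence by
    less than L.\<close>
  define k where "k = nat \<lceil>L / s\<rceil>"
  have "L / s \<le> real k" "real k < L / s + 1"
    unfolding k_def using p L by (auto simp: of_nat_ceiling) (linarith | simp add: ceiling_less_iff)+
  then have "L \<le> real k * s" "real k * s < L + s" using p by (auto simp: field_simps)
  then have "real k * s \<in> {L..2 * L}" using False by simp
  then show ?thesis
    using p flow_multiple_period[of p s k] by (auto simp: short_periodic_def intro!: bexI[of _ "real k * s"])
qed

text \<open>Robustness with Y = X gives each q a time at which it is contracted, and continuity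
  passes this to a ball. A finite subcover leaves finitely many waiting times, although no common
  rate was known beforehand.\<close>

lemma decay_near_short_periodic:
  assumes L: "0 < L"
  obtains C \<kappa> \<eta> where "0 < C" "0 < \<kappa>" "0 < \<eta>"
    "\<And>w \<tau>. w \<in> W \<Longrightarrow> 0 \<le> \<tau> \<Longrightarrow> (\<And>t. 0 \<le> t \<Longrightarrow> t \<le> \<tau> \<Longrightarrow> \<exists>q\<in>short_periodic L. dist (\<phi> t w) q < \<eta>) \<Longrightarrow>
      norm (F \<tau> w) \<le> C * exp (- (\<kappa> * \<tau>))"
proof -
  let ?Q = "short_periodic L"
  have "\<exists>T r. 1 \<le> T \<and> 0 < r \<and> (\<forall>v\<in>W. dist v q < r \<longrightarrow> norm (F T v) \<le> 1/2)" if q: "q \<in> ?Q" for q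
  proof -
    obtain s where s: "s \<in> {L..2 * L}" "\<phi> s q = q" "q \<in> W" using q by (auto simp: short_periodic_def)
    then have "periodic_point W \<phi> q" using L by (auto simp: periodic_point_def intro!: exI[of _ s])
    then have "((\<lambda>t. F t q) \<longlongrightarrow> 0) at_top" using \<epsilon>_pos by (intro robust continuous_X) auto
    then have "\<forall>\<^sub>F t in at_top. dist (F t q) 0 < 1/2" by (rule tendstoD) simp
    then have "\<forall>\<^sub>F t in at_top. 1 \<le> t \<and> dist (F t q) 0 < 1/2"
      using eventually_ge_at_top by (rule eventually_conj[rotated])
    then obtain T where T: "1 \<le> T" "norm (F T q) < 1/2"
      by (auto dest!: eventually_happens'[OF trivial_limit_at_top_linorder])
    have "continuous_on W (F T)" using T by (intro continuous_F) auto
    then obtain r where r: "0 < r" "\<And>v. v \<in> W \<Longrightarrow> dist v q < r \<Longrightarrow> dist (F T v) (F T q) < 1/2 - norm (F T q)"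
      using s(3) T unfolding continuous_on_iff by (metis diff_gt_0_iff_gt)
    have "norm (F T v) \<le> 1/2" if "v \<in> W" "dist v q < r" for v
      using r(2)[OF that] norm_triangle_sub[of "F T v" "F T q"] by (simp add: dist_norm)
    then show ?thesis using T r(1) by blast
  qed
  then obtain T r where Tr: "\<And>q. q \<in> ?Q \<Longrightarrow> 1 \<le> T q" "\<And>q. q \<in> ?Q \<Longrightarrow> 0 < r q"
    "\<And>q v. q \<in> ?Q \<Longrightarrow> v \<in> W \<Longrightarrow> dist v q < r q \<Longrightarrow> norm (F (T q) v) \<le> 1/2"
    by metis
  have Q: "compact ?Q" using L by (intro compact_short_periodic) auto
  obtain D where D: "D \<subseteq> ?Q" "finite D" "?Q \<subseteq> (\<Union>q\<in>D. ball q (r q))"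
    by (rule compactE_image[OF Q, of ?Q "\<lambda>q. ball q (r q)"]) (use Tr in auto)
  \<comment> \<open>\<eta> is a Lebesgue number of the cover: points \<eta>-close to the set share a
    ball, and hence a waiting time, of the cover.\<close>
  obtain \<eta> where \<eta>: "0 < \<eta>" "\<And>q. q \<in> ?Q \<Longrightarrow> \<exists>G\<in>(\<lambda>q. ball q (r q)) ` D. ball q \<eta> \<subseteq> G"
    using Heine_Borel_lemma[OF Q D(3)] by auto
  define b where "b = Max (insert 1 (T ` D))"
  have b: "1 \<le> b" "\<And>q. q \<in> D \<Longrightarrow> T q \<le> b" using D by (auto simp: b_def)
  obtain m where m: "1 \<le> m" "\<And>t w. w \<in> W \<Longrightarrow> 0 \<le> t \<Longrightarrow> t \<le> b \<Longrightarrow> norm (F t w) \<le> m"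
    using F_bound[of b] by blast
  define U where "U = {u \<in> W. \<exists>q\<in>?Q. dist u q < \<eta>}"
  show thesis
  proof (rule that[of "2 * m" "ln 2 / b" \<eta>])
    show "0 < 2 * m" "0 < ln 2 / b" "0 < \<eta>" using m b \<eta> by auto
    fix w \<tau> assume w: "w \<in> W" "0 \<le> \<tau>" "\<And>t. 0 \<le> t \<Longrightarrow> t \<le> \<tau> \<Longrightarrow> \<exists>q\<in>?Q. dist (\<phi> t w) q < \<eta>"
    have "norm (F \<tau> w) \<le> 2 * m * (1/2) powr (\<tau> / b)"
    proof (rule F_decay_along_segment[where U = U])
      fix u assume "u \<in> U"
      then obtain q where q: "u \<in> W" "q \<in> ?Q" "dist u q < \<eta>" by (auto simp: U_def)
      then obtain q' where q': "q' \<in> D" "ball q \<eta> \<subseteq> ball q' (r q')" using \<eta>(2) by blast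
      have "u \<in> ball q \<eta>" using q by (simp add: dist_commute)
      then have "u \<in> ball q' (r q')" using q' by blast
      then have "norm (F (T q') u) \<le> 1/2" using q' D q by (intro Tr(3)) (auto simp: dist_commute)
      then show "\<exists>T. 1 \<le> T \<and> T \<le> b \<and> norm (F T u) \<le> 1/2" using b(2) q' D Tr(1) by blast
    qed (use w m b in \<open>auto simp: U_def\<close>)
    also have "(1/2::real) powr (\<tau> / b) = exp (- (ln 2 / b * \<tau>))"
      by (simp add: powr_def ln_div mult.commute)
    finally show "norm (F \<tau> w) \<le> 2 * m * exp (- (ln 2 / b * \<tau>))" .
  qed
qed

end

subsection \<open>Closing and loop erasure\<close>

context robust_system
begin

text \<open>Outside \<open>short_periodic L\<close> return times exceed 2 L, so they cannot
  accumulate at 0 and a least one exists.\<close>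

lemma minimal_period_exists:
  assumes p: "p \<in> W" "0 < T" "\<phi> T p = p" and L: "0 < L" "p \<notin> short_periodic L"
  obtains \<tau> k where "minimal_period p \<tau>" "L \<le> \<tau>" "T = real k * \<tau>"
proof -
  have long: "2 * L < s" if "0 < s" "\<phi> s p = p" for s
    using short_periodicI[of p s L] that p L by force
  define S where "S = {s \<in> {2 * L..T}. dist (\<phi> s p) p = 0}"
  have "continuous_on {2 * L..T} (\<lambda>s. dist (\<phi> s p) p)"
    using L p by (intro continuous_intros continuous_orbit) auto
  then have "closedin (top_of_set {2 * L..T}) S"
    unfolding S_def by (rule continuous_closedin_preimage_constant)
  then have "compact S" by (rule closedin_compact[OF compact_Icc])
  moreover have "T \<in> S" using long[of T] p by (auto simp: S_def)
  ultimately obtain \<tau> where \<tau>: "\<tau> \<in> S" "\<And>s. s \<in> S \<Longrightarrow> \<tau> \<le> s"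
    using compact_attains_inf[of S] by blast
  have \<tau>_pos: "0 < \<tau>" and per: "\<phi> \<tau> p = p" and "2 * L \<le> \<tau>" "\<tau> \<le> T"
    using \<tau>(1) L by (auto simp: S_def)
  have no_period: "\<phi> s p \<noteq> p" if "0 < s" "s < \<tau>" for s
  proof
    assume "\<phi> s p = p"
    then have "s \<in> S" using long[of s] that \<open>\<tau> \<le> T\<close> by (auto simp: S_def)
    then show False using \<tau>(2) that by force
  qed
  \<comment> \<open>The remainder of T modulo \<tau> would be a return time below \<tau> if it were
    positive.\<close>
  define k where "k = nat \<lfloor>T / \<tau>\<rfloor>"
  define r where "r = T - real k * \<tau>"
  have "real k = of_int \<lfloor>T / \<tau>\<rfloor>" using p \<tau>_pos by (simp add: k_def)
  then have "real k \<le> T / \<tau>" "T / \<tau> < real k + 1" by linarith+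
  then have r: "0 \<le> r" "r < \<tau>" using \<tau>_pos by (auto simp: r_def field_simps)
  have "p = \<phi> (r + real k * \<tau>) p" using p by (simp add: r_def)
  also have "\<dots> = \<phi> r (\<phi> (real k * \<tau>) p)" using r p \<tau>_pos by (intro flow_add) auto
  also have "\<dots> = \<phi> r p" using flow_multiple_period[OF p(1) _ per] \<tau>_pos by simp
  finally have "r = 0" using no_period[of r] r by fastforce
  then have "T = real k * \<tau>" by (simp add: r_def)
  moreover have "minimal_period p \<tau>"
    using p(1) \<tau>_pos per no_period by (simp add: minimal_period_def)
  moreover have "L \<le> \<tau>" using \<open>2 * L \<le> \<tau>\<close> L by simp
  ultimately show thesis using that by blast
qed

text \<open>Whether the shadowing periodic point p has a short period decides the argument: either
  the segment stays near a compact set of uniform contraction, or it is cut into blocks of one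
  minimal period of p.\<close>

lemma close_return_decay:
  assumes closing: "closing_by_periodic_orbits W \<phi>"
  obtains C \<kappa> \<delta> where "0 < \<kappa>" "0 < \<delta>"
    "\<And>w n. w \<in> W \<Longrightarrow> 1 \<le> n \<Longrightarrow> dist w (\<phi> (real n) w) < \<delta> \<Longrightarrow> norm (F (real n) w) \<le> C * exp (- (\<kappa> * real n))"
proof -
  obtain c where c: "0 < c" "\<And>w. w \<in> W \<Longrightarrow> norm (X w) \<le> c" using bound_X by blast
  obtain C1 \<kappa>1 where C1: "0 < C1" "0 < \<kappa>1"
    "\<And>p \<tau> A M. minimal_period p \<tau> \<Longrightarrow> 1 \<le> \<tau> \<Longrightarrow> continuous_on {0..\<tau>} A \<Longrightarrow>
      (\<And>t. 0 \<le> t \<Longrightarrow> t \<le> \<tau> \<Longrightarrow> norm (A t) \<le> c) \<Longrightarrow>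
      (\<And>t. 0 \<le> t \<Longrightarrow> t \<le> \<tau> \<Longrightarrow> norm (A t - X (\<phi> t p)) \<le> \<rho> / 4) \<Longrightarrow>
      (\<And>t. 0 \<le> t \<Longrightarrow> t \<le> \<tau> \<Longrightarrow> (M has_vector_derivative A t ** M t) (at t within {0..\<tau>})) \<Longrightarrow>
      M 0 = mat 1 \<Longrightarrow> norm (M \<tau>) \<le> C1 * exp (- (\<kappa>1 * \<tau>))"
    using period_matrix_decay[of c] c(1) by (metis less_imp_le)
  \<comment> \<open>For \<open>L \<le> \<tau>\<close> the factor \<open>C1\<close> is at most
    \<open>exp (\<kappa>1 / 2 * \<tau>)\<close>, so each period contracts with half the rate and no
    constant. The 1 supplies the lower bound on periods required for \<open>C1\<close>.\<close>
  define L where "L = max 1 (2 * C1 / \<kappa>1)"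
  have L: "1 \<le> L" by (simp add: L_def)
  then have L_pos: "0 < L" by simp
  have absorb: "C1 * exp (- (\<kappa>1 * \<tau>)) \<le> exp (- (\<kappa>1 / 2 * \<tau>))" if "L \<le> \<tau>" for \<tau>
  proof -
    have "C1 \<le> \<kappa>1 / 2 * \<tau>"
      using that C1(2) by (simp add: L_def field_simps)
    also have "\<dots> \<le> exp (\<kappa>1 / 2 * \<tau>)" using exp_ge_add_one_self[of "\<kappa>1 / 2 * \<tau>"] by linarith
    finally have "C1 * exp (- (\<kappa>1 * \<tau>)) \<le> exp (\<kappa>1 / 2 * \<tau>) * exp (- (\<kappa>1 * \<tau>))"
      by (rule mult_right_mono) simp
    also have "\<dots> = exp (- (\<kappa>1 / 2 * \<tau>))" by (simp add: exp_add[symmetric])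
    finally show ?thesis .
  qed
  obtain C2 \<kappa>2 \<eta>2 where C2: "0 < C2" "0 < \<kappa>2" "0 < \<eta>2"
    "\<And>w \<tau>. w \<in> W \<Longrightarrow> 0 \<le> \<tau> \<Longrightarrow> (\<And>t. 0 \<le> t \<Longrightarrow> t \<le> \<tau> \<Longrightarrow> \<exists>q\<in>short_periodic L. dist (\<phi> t w) q < \<eta>2) \<Longrightarrow>
      norm (F \<tau> w) \<le> C2 * exp (- (\<kappa>2 * \<tau>))"
    using decay_near_short_periodic[OF L_pos] by blast
  have "uniformly_continuous_on W X"
    using continuous_X compact_W by (rule compact_uniformly_continuous)
  moreover have "0 < \<rho> / 4" using \<rho>_pos by simp
  ultimately obtain \<eta>1 where \<eta>1: "0 < \<eta>1"
    "\<And>u v. u \<in> W \<Longrightarrow> v \<in> W \<Longrightarrow> dist u v < \<eta>1 \<Longrightarrow> dist (X u) (X v) < \<rho> / 4"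
    unfolding uniformly_continuous_on_def by metis
  define \<eta> where "\<eta> = min \<eta>1 \<eta>2"
  have \<eta>: "0 < \<eta>" using \<eta>1 C2 by (simp add: \<eta>_def)
  obtain \<delta> where \<delta>_pos: "0 < \<delta>" and \<delta>: "\<forall>w\<in>W. \<forall>\<tau>\<ge>1. 0 < dist w (\<phi> \<tau> w) \<and> dist w (\<phi> \<tau> w) < \<delta> \<longrightarrow>
      (\<exists>p\<in>W. p = \<phi> \<tau> p \<and> (\<forall>t. 0 \<le> t \<and> t \<le> \<tau> \<longrightarrow> dist (\<phi> t w) (\<phi> t p) < \<eta>))"
    using closing[unfolded closing_by_periodic_orbits_def, THEN spec, THEN mp, OF \<eta>] by (elim exE conjE)
  define \<kappa> where "\<kappa> = min (\<kappa>1 / 2) \<kappa>2"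
  define C where "C = max (real CARD('d)) C2"
  have weaken: "c' * exp (- (\<kappa>' * real n)) \<le> C * exp (- (\<kappa> * real n))"
    if "0 \<le> c'" "c' \<le> C" "\<kappa> \<le> \<kappa>'" for c' \<kappa>' n
    using that by (intro mult_mono) (auto simp: mult_right_mono)
  show thesis
  proof (rule that[of \<kappa> \<delta> C])
    show "0 < \<kappa>" "0 < \<delta>" using C1 C2 \<delta>_pos by (auto simp: \<kappa>_def)
    fix w and n :: nat assume w: "w \<in> W" and n: "1 \<le> n" and close: "dist w (\<phi> (real n) w) < \<delta>"
    \<comment> \<open>The closing property says nothing about exact returns; then w is periodic and
      shadows itself.\<close>
    have "\<exists>p\<in>W. p = \<phi> (real n) p \<and> (\<forall>t. 0 \<le> t \<and> t \<le> real n \<longrightarrow> dist (\<phi> t w) (\<phi> t p) < \<eta>)"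
    proof (cases "dist w (\<phi> (real n) w) = 0")
      case True
      then show ?thesis using w \<eta> by (intro bexI[of _ w]) auto
    next
      case False
      then have "0 < dist w (\<phi> (real n) w)" by simp
      then show ?thesis
        using \<delta>[THEN bspec, OF w, THEN spec, of "real n"] n close by simp
    qed
    then obtain p where p: "p \<in> W" "\<phi> (real n) p = p"
      and shadow: "\<And>t. 0 \<le> t \<Longrightarrow> t \<le> real n \<Longrightarrow> dist (\<phi> t w) (\<phi> t p) < \<eta>" by metis
    show "norm (F (real n) w) \<le> C * exp (- (\<kappa> * real n))"
    proof (cases "p \<in> short_periodic L")
      case True
      have "norm (F (real n) w) \<le> C2 * exp (- (\<kappa>2 * real n))"
      proof (rule C2(4)[OF w])
        fix t assume t: "0 \<le> t" "t \<le> real n"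
        show "\<exists>q\<in>short_periodic L. dist (\<phi> t w) q < \<eta>2"
          using shadow[OF t] short_periodic_flow[OF True t(1)] L
          by (intro bexI[of _ "\<phi> t p"]) (auto simp: \<eta>_def)
      qed simp
      also have "\<dots> \<le> C * exp (- (\<kappa> * real n))"
        using C2 by (intro weaken) (auto simp: C_def \<kappa>_def)
      finally show ?thesis .
    next
      case False
      then obtain \<tau> k where \<tau>: "minimal_period p \<tau>" "L \<le> \<tau>" and nk: "real n = real k * \<tau>"
        using minimal_period_exists[of p "real n" L] p n L by auto
      have \<tau>_pos: "0 < \<tau>" and per: "\<phi> \<tau> p = p" using \<tau>(1) by (auto simp: minimal_period_def)
      \<comment> \<open>Since p is back at its start after each block, every block of w runs along
        the same periodic orbit, and its own solution serves as M. The dimension only bounds the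
        norm of the identity at i = 0.\<close>
      have "i \<le> k \<Longrightarrow> norm (F (real i * \<tau>) w) \<le> CARD('d) * exp (- (\<kappa>1 / 2 * (real i * \<tau>)))" for i
      proof (induction i)
        case 0
        then show ?case using w norm_mat_1_le[where 'n='d] by simp
      next
        case (Suc i)
        let ?s = "real i * \<tau>"
        have s: "0 \<le> ?s" using \<tau>_pos by simp
        have "norm (F \<tau> (\<phi> ?s w)) \<le> C1 * exp (- (\<kappa>1 * \<tau>))"
        proof (rule C1(3)[OF \<tau>(1), where A = "\<lambda>t. X (\<phi> t (\<phi> ?s w))" and M = "\<lambda>t. F t (\<phi> ?s w)"])
          show "1 \<le> \<tau>" using \<tau>(2) L by simp
          show "continuous_on {0..\<tau>} (\<lambda>t. X (\<phi> t (\<phi> ?s w)))"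
            using w s by (intro continuous_X_orbit) auto
          show "F 0 (\<phi> ?s w) = mat 1" using w s by simp
          fix t assume t: "0 \<le> t" "t \<le> \<tau>"
          show "norm (X (\<phi> t (\<phi> ?s w))) \<le> c" using w s t by (intro c) auto
          show "((\<lambda>t. F t (\<phi> ?s w)) has_vector_derivative X (\<phi> t (\<phi> ?s w)) ** F t (\<phi> ?s w)) (at t within {0..\<tau>})"
            using w s t by (intro F_deriv) auto
          have "real (Suc i) * \<tau> \<le> real k * \<tau>" using Suc.prems \<tau>_pos by (intro mult_right_mono) auto
          then have "t + ?s \<le> real n" using t nk by (simp add: algebra_simps)
          then have "dist (\<phi> (t + ?s) w) (\<phi> (t + ?s) p) < \<eta>" using s t by (intro shadow) auto
          moreover have "\<phi> (t + ?s) p = \<phi> t p"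
            using flow_add[of t ?s p] flow_multiple_period[of p \<tau> i] p per s t \<tau>_pos by simp
          ultimately have "dist (X (\<phi> t (\<phi> ?s w))) (X (\<phi> t p)) < \<rho> / 4"
            using flow_add[of t ?s w] w p s t by (intro \<eta>1(2)) (auto simp: \<eta>_def)
          then show "norm (X (\<phi> t (\<phi> ?s w)) - X (\<phi> t p)) \<le> \<rho> / 4" by (simp add: dist_norm)
        qed
        also have "\<dots> \<le> exp (- (\<kappa>1 / 2 * \<tau>))" by (rule absorb[OF \<tau>(2)])
        finally have "norm (F \<tau> (\<phi> ?s w) ** F ?s w) \<le> exp (- (\<kappa>1 / 2 * \<tau>)) * (CARD('d) * exp (- (\<kappa>1 / 2 * ?s)))"
          using Suc by (intro norm_matrix_mult_mono) auto
        moreover have "F (real (Suc i) * \<tau>) w = F \<tau> (\<phi> ?s w) ** F ?s w"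
          using F_cocycle[of w \<tau> ?s] w s \<tau>_pos by (simp add: algebra_simps)
        moreover have "exp (- (\<kappa>1 / 2 * \<tau>)) * exp (- (\<kappa>1 / 2 * ?s)) = exp (- (\<kappa>1 / 2 * (real (Suc i) * \<tau>)))"
          by (simp add: exp_add[symmetric] algebra_simps)
        ultimately show ?case by (simp only: mult.left_commute)
      qed
      from this[of k] have "norm (F (real n) w) \<le> CARD('d) * exp (- (\<kappa>1 / 2 * real n))"
        by (simp add: nk)
      also have "\<dots> \<le> C * exp (- (\<kappa> * real n))"
        by (intro weaken) (auto simp: C_def \<kappa>_def)
      finally show ?thesis .
    qed
  qed
qed

end

context driven_system
begin

text \<open>An orbit segment is cut at the last visit to the cell of its initial point. The part before the
  cut is a close return, and the part after it avoids that cell, so that at most \<open>card S\<close> close returns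
  and single time steps cover the segment.\<close>
lemma loop_erasure:
  assumes "finite S" and m: "1 \<le> m" "\<And>w. w \<in> W \<Longrightarrow> norm (F 1 w) \<le> m" and \<kappa>: "0 < \<kappa>" and C: "1 \<le> C"
    and return_decay: "\<And>w n. w \<in> W \<Longrightarrow> dist w (\<phi> (real n) w) < \<delta> \<Longrightarrow>
      norm (F (real n) w) \<le> C * exp (- (\<kappa> * real n))"
    and "w \<in> W" and "\<And>i. i \<le> n \<Longrightarrow> \<exists>c\<in>S. dist c (\<phi> (real i) w) < \<delta> / 2"
  shows "norm (F (real n) w) \<le> (m * C * exp \<kappa>) ^ card S * exp (- (\<kappa> * real n))"
  using \<open>finite S\<close> assms(7,8)
proof (induction S arbitrary: w n rule: finite_psubset_induct)
  case (psubset S)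
  note w = psubset.prems(1) and cover = psubset.prems(2)
  \<comment> \<open>The price of one cell: C for its loop, m for the single step that leaves it, and
    \<open>exp \<kappa>\<close> for the unit of time in which that step need not decay.\<close>
  define D where "D = m * C * exp \<kappa>"
  have mC: "1 * 1 \<le> m * C" using m C by (intro mult_mono) auto
  have "m * C * 1 \<le> D" unfolding D_def using \<kappa> mC by (intro mult_left_mono) auto
  moreover have "1 * C \<le> m * C" using m C by (intro mult_right_mono) auto
  ultimately have CD: "C \<le> D" by simp
  then have D1: "1 \<le> D" using C by simp
  obtain c where c: "c \<in> S" "dist c w < \<delta> / 2" using cover[of 0] w by auto
  have card: "card S = Suc (card (S - {c}))" using c(1) psubset.hyps by (metis card_Suc_Diff1)
  define J where "J = {j. j \<le> n \<and> dist c (\<phi> (real j) w) < \<delta> / 2}"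
  have J: "finite J" "0 \<in> J" using c w by (auto simp: J_def)
  define j where "j = Max J"
  have "j \<in> J" unfolding j_def using J by (intro Max_in) auto
  then have j: "j \<le> n" "dist c (\<phi> (real j) w) < \<delta> / 2" by (auto simp: J_def)
  have j_last: "i \<le> j" if "i \<in> J" for i unfolding j_def using J that by simp
  \<comment> \<open>Both points lie within \<open>\<delta> / 2\<close> of c. For j = 0 the loop is
    trivial, which is why decay is also assumed for return time 0.\<close>
  have "dist w (\<phi> (real j) w) < \<delta>"
    using dist_triangle_half_r[OF c(2) j(2)] .
  then have loop: "norm (F (real j) w) \<le> C * exp (- (\<kappa> * real j))" by (rule return_decay[OF w])
  show ?case
  proof (cases "j = n")
    case True
    have "D ^ 1 \<le> D ^ card S" using D1 by (intro power_increasing) (auto simp: card)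
    then have "C \<le> D ^ card S" using CD by simp
    then have "C * exp (- (\<kappa> * real n)) \<le> D ^ card S * exp (- (\<kappa> * real n))"
      by (rule mult_right_mono) simp
    then show ?thesis using loop unfolding True D_def by (rule order_trans[rotated])
  next
    case False
    define w' where "w' = \<phi> (real (Suc j)) w"
    define k where "k = n - Suc j"
    have n: "n = k + Suc j" using False j(1) by (simp add: k_def)
    have w': "w' \<in> W" using w by (simp add: w'_def)
    have shift: "\<phi> (real i) w' = \<phi> (real (i + Suc j)) w" for i
      unfolding w'_def of_nat_add using flow_add[of "real i" "real (Suc j)" w] w by (simp del: of_nat_Suc)
    have "norm (F (real k) w') \<le> (m * C * exp \<kappa>) ^ card (S - {c}) * exp (- (\<kappa> * real k))"
    proof (rule psubset.IH[OF _ w'])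
      show "S - {c} \<subset> S" using c by blast
      fix i assume i: "i \<le> k"
      then obtain c' where c': "c' \<in> S" "dist c' (\<phi> (real (i + Suc j)) w) < \<delta> / 2"
        using cover[of "i + Suc j"] n by auto
      have "i + Suc j \<notin> J" using j_last[of "i + Suc j"] by auto
      then have "c' \<noteq> c" using c'(2) i n by (auto simp: J_def)
      then show "\<exists>c\<in>S - {c}. dist c (\<phi> (real i) w') < \<delta> / 2"
        using c' unfolding shift by blast
    qed
    moreover have "norm (F 1 (\<phi> (real j) w) ** F (real j) w) \<le> m * (C * exp (- (\<kappa> * real j)))"
      using w by (intro norm_matrix_mult_mono m(2) loop) auto
    then have "norm (F (real (Suc j)) w) \<le> m * (C * exp (- (\<kappa> * real j)))"
      using F_cocycle[of w 1 "real j"] w by (simp add: add.commute)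
    ultimately have "norm (F (real k) w' ** F (real (Suc j)) w) \<le>
        (m * C * exp \<kappa>) ^ card (S - {c}) * exp (- (\<kappa> * real k)) * (m * (C * exp (- (\<kappa> * real j))))"
      by (rule norm_matrix_mult_mono)
    moreover have "F (real n) w = F (real k) w' ** F (real (Suc j)) w"
      unfolding n w'_def of_nat_add using F_cocycle[of w "real k" "real (Suc j)"] w by (simp del: of_nat_Suc)
    moreover have "exp (- (\<kappa> * real k)) * exp (- (\<kappa> * real j)) = exp \<kappa> * exp (- (\<kappa> * real n))"
      by (simp add: n exp_add[symmetric] algebra_simps)
    then have "(m * C * exp \<kappa>) ^ card (S - {c}) * exp (- (\<kappa> * real k)) * (m * (C * exp (- (\<kappa> * real j)))) =
        (m * C * exp \<kappa>) ^ card S * exp (- (\<kappa> * real n))"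
      by (simp add: card mult_ac)
    ultimately show ?thesis by simp
  qed
qed

end

section \<open>From close returns to uniform contraction\<close>

text \<open>The constant from loop erasure depends on the size of a finite cover but not on the
  length of the segment, so a long enough segment contracts from every starting point.\<close>

lemma (in robust_system) exponentially_decaying_of_closing:
  assumes closing: "closing_by_periodic_orbits W \<phi>"
  shows exponentially_decaying
proof -
  obtain C0 \<kappa> \<delta> where C0: "0 < \<kappa>" "0 < \<delta>"
    "\<And>w n. w \<in> W \<Longrightarrow> 1 \<le> n \<Longrightarrow> dist w (\<phi> (real n) w) < \<delta> \<Longrightarrow> norm (F (real n) w) \<le> C0 * exp (- (\<kappa> * real n))"
    using close_return_decay[OF closing] by metis
  define C where "C = max (real CARD('d)) C0"
  have C: "1 \<le> C" by (simp add: C_def Suc_le_eq le_max_iff_disj)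
  \<comment> \<open>Return time 0 has to be included here; the norm of the identity is bounded only
    by the dimension, hence the maximum in C.\<close>
  have return_decay: "norm (F (real n) w) \<le> C * exp (- (\<kappa> * real n))"
    if "w \<in> W" "dist w (\<phi> (real n) w) < \<delta>" for w n
  proof (cases "n = 0")
    case True
    then show ?thesis using that norm_mat_1_le[where 'n='d] by (simp add: C_def)
  next
    case False
    then have "norm (F (real n) w) \<le> C0 * exp (- (\<kappa> * real n))" using that by (intro C0(3)) auto
    also have "\<dots> \<le> C * exp (- (\<kappa> * real n))" by (intro mult_right_mono) (auto simp: C_def)
    finally show ?thesis .
  qed
  obtain m where m: "1 \<le> m" "\<And>t w. w \<in> W \<Longrightarrow> 0 \<le> t \<Longrightarrow> t \<le> 1 \<Longrightarrow> norm (F t w) \<le> m"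
    using F_bound[of 1] by blast
  obtain S where S: "finite S" "W \<subseteq> (\<Union>c\<in>S. ball c (\<delta> / 2))"
    by (rule compactE_image[OF compact_W, of W "\<lambda>c. ball c (\<delta> / 2)"]) (use C0(2) in auto)
  define K where "K = (m * C * exp \<kappa>) ^ card S"
  have K: "0 < K" using m C by (simp add: K_def)
  \<comment> \<open>Then 2 K is below \<open>\<kappa> * real n\<close>, hence below
    \<open>exp (\<kappa> * real n)\<close>.\<close>
  obtain n where n: "2 * K / \<kappa> < real n" using reals_Archimedean2 by blast
  have n1: "1 \<le> real n"
  proof -
    have "0 < 2 * K / \<kappa>" using K C0 by simp
    then have "0 < real n" using n by linarith
    then show ?thesis by (simp add: Suc_le_eq)
  qed
  have "K * exp (- (\<kappa> * real n)) \<le> 1/2"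
  proof -
    have "2 * K < \<kappa> * real n" using n C0(1) by (simp add: field_simps)
    also have "\<dots> \<le> exp (\<kappa> * real n)" using exp_ge_add_one_self[of "\<kappa> * real n"] by linarith
    finally show ?thesis by (simp add: exp_minus field_simps)
  qed
  moreover have "norm (F (real n) w) \<le> K * exp (- (\<kappa> * real n))" if w: "w \<in> W" for w
    unfolding K_def
  proof (rule loop_erasure[OF S(1) m(1) _ C0(1) C return_decay w])
    show "norm (F 1 w) \<le> m" if "w \<in> W" for w using that by (intro m) auto
    fix i :: nat
    have "\<phi> (real i) w \<in> W" using w by simp
    then have "\<phi> (real i) w \<in> (\<Union>c\<in>S. ball c (\<delta> / 2))" by (rule subsetD[OF S(2)])
    then show "\<exists>c\<in>S. dist c (\<phi> (real i) w) < \<delta> / 2" by (simp only: UN_iff mem_ball)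
  qed
  ultimately show ?thesis
    by (intro exponentially_decaying_if_contraction[OF n1]) (blast intro: order_trans)
qed

theorem theorem1p8:
  fixes W :: "'w::metric_space set"
    and \<phi> :: "real \<Rightarrow> 'w \<Rightarrow> 'w"
    and N :: "real ^ 'd::finite \<Rightarrow> real"
    and X :: "'w \<Rightarrow> real ^ 'd ^ 'd"
  assumes "vector_norm N"
    and "compact W"
    and "continuous_semiflow_on W \<phi>"
    and "closing_by_periodic_orbits W \<phi>"
    and "continuous_on W X"
  shows "robustly_periodically_stable N W \<phi> X \<longleftrightarrow> uniformly_exponentially_stable N W \<phi> X"
proof -
  interpret driven_system W \<phi> X
    using assms by unfold_locales
  have exponentially_decaying if stable: "robustly_periodically_stable N W \<phi> X"
  proof -
    obtain \<epsilon> where \<epsilon>: "0 < \<epsilon>"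
      "\<And>Y p. continuous_on W Y \<Longrightarrow> (\<And>w. w \<in> W \<Longrightarrow> norm (X w - Y w) \<le> \<epsilon>) \<Longrightarrow>
         periodic_point W \<phi> p \<Longrightarrow> ((\<lambda>t. fundamental_matrix \<phi> Y t p) \<longlongrightarrow> 0) at_top"
      using robust_imp_tendsto_0[OF assms(1) stable] by metis
    interpret robust_system W \<phi> X \<epsilon>
      by unfold_locales (use \<epsilon> in blast)+
    show ?thesis using assms(4) by (rule exponentially_decaying_of_closing)
  qed
  then show ?thesis
    using exponentially_decaying_imp_robust[OF assms(1)] uniformly_exponentially_stable_iff[OF assms(1)] by blast
qed

end
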